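(* Let $(W,\omega)$ be a real symplectic vector space of dimension $2n$ and let $C\subset\mathscr{L}(W)$ be a regular cycle. Then for each $\Lambda\in C$, $C\setminus\{\Lambda\}$ is a (regular) Jacobi curve, and every projective reparametrization $\Gamma=\Gamma(t)$ of it has vanishing curvature operator, $R_\Gamma(t)=0$ for all $t$.
   Context: $(u|v):=\omega(u,v)$. $\mathscr{L}(W)$ is the Lagrangian Grassmannian; $\Lambda^{\pitchfork}$ is the open set of Lagrangian subspaces transverse to $\Lambda$. Affine structure: for $\Gamma_0\in\Delta^{\pitchfork}$, each $\Gamma\in\Delta^{\pitchfork}$ is the graph of a unique linear map $\Gamma_0\to\Delta$, and this identifies $\Delta^{\pitchfork}$ with the vector space of linear maps $A\colon\Gamma_0\to\Delta$ with $(Au|v)+(u|Av)=0$; the affine structure so defined on $\Delta^{\pitchfork}$ is independent of the origin $\Gamma_0$. An affine line $L$ in $\overline\Lambda^{\pitchfork}$ ($\overline\Lambda\in\mathscr{L}(W)$) is regular if $\Lambda_1\cap\Lambda_2=\{0\}$ for all $\Lambda_1\neq\Lambda_2$ in $L$. A cycle is a set $C=L\cup\{\overline\Lambda\}$ with $\overline\Lambda\in\mathscr{L}(W)$ and $L$ an affine line in $\overline\Lambda^{\pitchfork}$; it is regular if $L$ is regular. A (regular) Jacobi curve is a smooth curve $\Gamma(t)$ in $\mathscr{L}(W)$, $t$ in an open interval, such that for every $t_0$ the quadratic form $\dot\Gamma(t_0)(v_0)=\omega(v_0,v'(t_0))$ on $\Gamma(t_0)$ (with $v(t)\in\Gamma(t)$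 any smooth curve, $v(t_0)=v_0$) is non-degenerate; a subset of $\mathscr{L}(W)$ is called a Jacobi curve if it is the image of an injective such curve, and its parametrizations are the smooth reparametrizations (with nowhere vanishing derivative) of it. For a Jacobi curve and each $\tau$ there is a unique $\Delta_\tau\in\Gamma(\tau)^{\pitchfork}$ such that $\Gamma$, viewed for $t$ near $\tau$ as a curve $\Gamma_{\Delta_\tau}$ in the affine space $\Delta_\tau^{\pitchfork}$, satisfies $\Gamma''_{\Delta_\tau}(\tau)=0$. With $\Gamma(\tau)$ as origin, $\Gamma'_{\Delta_\tau}(\tau)$ and $\Gamma'''_{\Delta_\tau}(\tau)$ are linear maps $\Gamma(\tau)\to\Delta_\tau$, the first invertible; the (Ricci) curvature operator is $R_\Gamma(\tau)=(\Gamma'_{\Delta_\tau}(\tau))^{-1}\circ\Gamma'''_{\Delta_\tau}(\tau)\colon\Gamma(\tau)\to\Gamma(\tau)$. A parametrization is projective if $\mathrm{tr}\,R_\Gamma(t)=0$ for all $t$. *)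

theory Defs
  imports "HOL-Analysis.Analysis"
begin

section \<open>Symplectic linear algebra\<close>

definition symplectic_form :: "('a::euclidean_space \<Rightarrow> 'a \<Rightarrow> real) \<Rightarrow> bool" where
  "symplectic_form \<omega> \<longleftrightarrow>
     bilinear \<omega> \<and> (\<forall>v. \<omega> v v = 0) \<and> (\<forall>u. (\<forall>v. \<omega> u v = 0) \<longrightarrow> u = 0)"

definition lagrangian_grassmannian ::
    "('a::euclidean_space \<Rightarrow> 'a \<Rightarrow> real) \<Rightarrow> 'a set set" where
  "lagrangian_grassmannian \<omega> =
     {\<Lambda>. subspace \<Lambda> \<and> (\<forall>u\<in>\<Lambda>. \<forall>v\<in>\<Lambda>. \<omega> u v = 0) \<and> 2 * dim \<Lambda> = DIM('a)}"

definition transversals ::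
    "('a::euclidean_space \<Rightarrow> 'a \<Rightarrow> real) \<Rightarrow> 'a set \<Rightarrow> 'a set set" where
  "transversals \<omega> \<Lambda> = {\<Gamma> \<in> lagrangian_grassmannian \<omega>. \<Gamma> \<inter> \<Lambda> = {0}}"


section \<open>The affine structure on the set of transversals\<close>

text \<open>
  Let \<open>\<Gamma>\<^sub>0\<close> be transverse to \<open>\<Delta>\<close>. A linear map from \<open>\<Gamma>\<^sub>0\<close> to \<open>\<Delta>\<close> is
  represented by its extension by zero on \<open>\<Delta>\<close> to the whole space, which is the direct sum of
  \<open>\<Gamma>\<^sub>0\<close> and \<open>\<Delta>\<close>. These extensions are the linear maps that take values in \<open>\<Delta>\<close> and
  vanish on \<open>\<Delta>\<close>; they form a vector subspace of the space of all linear maps.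
\<close>

definition lin_maps :: "'a::euclidean_space set \<Rightarrow> ('a \<Rightarrow>\<^sub>L 'a) set" where
  "lin_maps \<Delta> = {A. (\<forall>w. blinfun_apply A w \<in> \<Delta>) \<and> (\<forall>w\<in>\<Delta>. blinfun_apply A w = 0)}"

definition symmetric_maps ::
    "('a::euclidean_space \<Rightarrow> 'a \<Rightarrow> real) \<Rightarrow> 'a set \<Rightarrow> 'a set \<Rightarrow> ('a \<Rightarrow>\<^sub>L 'a) set" where
  "symmetric_maps \<omega> \<Gamma>\<^sub>0 \<Delta> =
     {A \<in> lin_maps \<Delta>. \<forall>u\<in>\<Gamma>\<^sub>0. \<forall>v\<in>\<Gamma>\<^sub>0. \<omega> (blinfun_apply A u) v + \<omega> u (blinfun_apply A v) = 0}"

definition graph_over :: "'a::euclidean_space set \<Rightarrow> ('a \<Rightarrow>\<^sub>L 'a) \<Rightarrow> 'a set" where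
  "graph_over \<Gamma>\<^sub>0 A = (\<lambda>u. u + blinfun_apply A u) ` \<Gamma>\<^sub>0"

definition graph_chart ::
    "'a::euclidean_space set \<Rightarrow> 'a set \<Rightarrow> 'a set \<Rightarrow> ('a \<Rightarrow>\<^sub>L 'a)" where
  "graph_chart \<Gamma>\<^sub>0 \<Delta> \<Gamma> = (THE A. A \<in> lin_maps \<Delta> \<and> \<Gamma> = graph_over \<Gamma>\<^sub>0 A)"

definition affine_line ::
    "('a::euclidean_space \<Rightarrow> 'a \<Rightarrow> real) \<Rightarrow> 'a set \<Rightarrow> 'a set set \<Rightarrow> bool" where
  "affine_line \<omega> \<Delta> L \<longleftrightarrow>
     (\<exists>\<Gamma>\<^sub>0\<in>transversals \<omega> \<Delta>. \<exists>A\<in>symmetric_maps \<omega> \<Gamma>\<^sub>0 \<Delta>. \<exists>B\<in>symmetric_maps \<omega> \<Gamma>\<^sub>0 \<Delta>.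
        B \<noteq> 0 \<and> L = range (\<lambda>s::real. graph_over \<Gamma>\<^sub>0 (A + s *\<^sub>R B)))"

definition regular_line :: "'a::euclidean_space set set \<Rightarrow> bool" where
  "regular_line L \<longleftrightarrow> (\<forall>\<Lambda>\<^sub>1\<in>L. \<forall>\<Lambda>\<^sub>2\<in>L. \<Lambda>\<^sub>1 \<noteq> \<Lambda>\<^sub>2 \<longrightarrow> \<Lambda>\<^sub>1 \<inter> \<Lambda>\<^sub>2 = {0})"

definition regular_cycle ::
    "('a::euclidean_space \<Rightarrow> 'a \<Rightarrow> real) \<Rightarrow> 'a set set \<Rightarrow> bool" where
  "regular_cycle \<omega> C \<longleftrightarrow>
     (\<exists>\<Delta>\<in>lagrangian_grassmannian \<omega>. \<exists>L. affine_line \<omega> \<Delta> L \<and> regular_line L \<and> C = insert \<Delta> L)"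


section \<open>Smooth curves\<close>

definition nth_deriv :: "nat \<Rightarrow> (real \<Rightarrow> 'b::real_normed_vector) \<Rightarrow> real \<Rightarrow> 'b" where
  "nth_deriv k f = ((\<lambda>g t. vector_derivative g (at t)) ^^ k) f"

definition smooth_on :: "real set \<Rightarrow> (real \<Rightarrow> 'b::real_normed_vector) \<Rightarrow> bool" where
  "smooth_on U f \<longleftrightarrow> (\<forall>k. \<forall>t\<in>U. nth_deriv k f differentiable (at t))"

definition open_interval :: "real set \<Rightarrow> bool" where
  "open_interval I \<longleftrightarrow> open I \<and> is_interval I \<and> I \<noteq> {}"

text \<open>Smoothness with respect to the atlas of the graph charts.\<close>

definition smooth_lagrangian_curve ::
    "('a::euclidean_space \<Rightarrow> 'a \<Rightarrow> real) \<Rightarrow> real set \<Rightarrow> (real \<Rightarrow> 'a set) \<Rightarrow> bool" where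
  "smooth_lagrangian_curve \<omega> I \<Gamma> \<longleftrightarrow>
     (\<forall>t\<in>I. \<Gamma> t \<in> lagrangian_grassmannian \<omega>) \<and>
     (\<forall>\<tau>\<in>I. \<exists>\<Delta>\<in>lagrangian_grassmannian \<omega>. \<exists>\<Gamma>\<^sub>0\<in>transversals \<omega> \<Delta>. \<exists>U\<subseteq>I.
        open U \<and> \<tau> \<in> U \<and> (\<forall>t\<in>U. \<Gamma> t \<in> transversals \<omega> \<Delta>) \<and>
        smooth_on U (\<lambda>t. graph_chart \<Gamma>\<^sub>0 \<Delta> (\<Gamma> t)))"


section \<open>Jacobi curves\<close>

text \<open>
  The value does not depend on the smooth curve \<open>v\<close>: two choices differ by a smooth curve in
  \<open>\<Gamma>\<close> that vanishes at \<open>\<tau>\<close>, hence has its derivative at \<open>\<tau>\<close> in the isotropic space \<open>\<Gamma> \<tau>\<close>.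
\<close>

definition velocity_form ::
    "('a::euclidean_space \<Rightarrow> 'a \<Rightarrow> real) \<Rightarrow> (real \<Rightarrow> 'a set) \<Rightarrow> real \<Rightarrow> 'a \<Rightarrow> real" where
  "velocity_form \<omega> \<Gamma> \<tau> v\<^sub>0 =
     (THE c. \<exists>v U. open U \<and> \<tau> \<in> U \<and> smooth_on U v \<and> (\<forall>t\<in>U. v t \<in> \<Gamma> t) \<and> v \<tau> = v\<^sub>0 \<and>
        c = \<omega> v\<^sub>0 (vector_derivative v (at \<tau>)))"

definition nondegenerate_quadratic_on :: "'a::real_vector set \<Rightarrow> ('a \<Rightarrow> real) \<Rightarrow> bool" where
  "nondegenerate_quadratic_on S q \<longleftrightarrow>
     (\<forall>u\<in>S. (\<forall>v\<in>S. q (u + v) - q u - q v = 0) \<longrightarrow> u = 0)"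

definition jacobi_curve ::
    "('a::euclidean_space \<Rightarrow> 'a \<Rightarrow> real) \<Rightarrow> real set \<Rightarrow> (real \<Rightarrow> 'a set) \<Rightarrow> bool" where
  "jacobi_curve \<omega> I \<Gamma> \<longleftrightarrow>
     open_interval I \<and> smooth_lagrangian_curve \<omega> I \<Gamma> \<and>
     (\<forall>\<tau>\<in>I. nondegenerate_quadratic_on (\<Gamma> \<tau>) (velocity_form \<omega> \<Gamma> \<tau>))"

definition injective_jacobi_curve_onto ::
    "('a::euclidean_space \<Rightarrow> 'a \<Rightarrow> real) \<Rightarrow> 'a set set \<Rightarrow> real set \<Rightarrow> (real \<Rightarrow> 'a set) \<Rightarrow> bool" where
  "injective_jacobi_curve_onto \<omega> S I \<Gamma> \<longleftrightarrow> jacobi_curve \<omega> I \<Gamma> \<and> inj_on \<Gamma> I \<and> \<Gamma> ` I = S"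

definition is_jacobi_curve_set ::
    "('a::euclidean_space \<Rightarrow> 'a \<Rightarrow> real) \<Rightarrow> 'a set set \<Rightarrow> bool" where
  "is_jacobi_curve_set \<omega> S \<longleftrightarrow> (\<exists>I \<Gamma>. injective_jacobi_curve_onto \<omega> S I \<Gamma>)"

text \<open>
  The change of parameter \<open>\<phi>\<close> need not be onto \<open>I\<close>. Projective parameters are related by
  fractional linear transformations, which in general are defined only on part of \<open>I\<close>.
\<close>

definition reparametrization ::
    "('a::euclidean_space \<Rightarrow> 'a \<Rightarrow> real) \<Rightarrow> 'a set set \<Rightarrow> real set \<Rightarrow> (real \<Rightarrow> 'a set) \<Rightarrow> bool" where
  "reparametrization \<omega> S J \<Gamma> \<longleftrightarrow>
     open_interval J \<and>
     (\<exists>I \<gamma> \<phi>. injective_jacobi_curve_onto \<omega> S I \<gamma> \<and>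
        \<phi> ` J \<subseteq> I \<and> smooth_on J \<phi> \<and> (\<forall>t\<in>J. vector_derivative \<phi> (at t) \<noteq> 0) \<and>
        (\<forall>t\<in>J. \<Gamma> t = \<gamma> (\<phi> t)))"


section \<open>Curvature\<close>

text \<open>
  \<open>chart_deriv \<Gamma> \<tau> \<Delta> k\<close> is the \<open>k\<close>-th derivative at \<open>\<tau>\<close> of \<open>\<Gamma>\<close>, seen near \<open>\<tau>\<close> as a curve in
  the affine space of transversals of \<open>\<Delta>\<close> with origin \<open>\<Gamma> \<tau>\<close>.
\<close>

definition chart_deriv ::
    "(real \<Rightarrow> 'a::euclidean_space set) \<Rightarrow> real \<Rightarrow> 'a set \<Rightarrow> nat \<Rightarrow> ('a \<Rightarrow>\<^sub>L 'a)" where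
  "chart_deriv \<Gamma> \<tau> \<Delta> k = nth_deriv k (\<lambda>t. graph_chart (\<Gamma> \<tau>) \<Delta> (\<Gamma> t)) \<tau>"

definition derivative_lagrangian ::
    "('a::euclidean_space \<Rightarrow> 'a \<Rightarrow> real) \<Rightarrow> (real \<Rightarrow> 'a set) \<Rightarrow> real \<Rightarrow> 'a set" where
  "derivative_lagrangian \<omega> \<Gamma> \<tau> =
     (THE \<Delta>. \<Delta> \<in> transversals \<omega> (\<Gamma> \<tau>) \<and> chart_deriv \<Gamma> \<tau> \<Delta> 2 = 0)"

text \<open>Only the values on \<open>\<Gamma> \<tau>\<close> are meaningful.\<close>

definition curvature_operator ::
    "('a::euclidean_space \<Rightarrow> 'a \<Rightarrow> real) \<Rightarrow> (real \<Rightarrow> 'a set) \<Rightarrow> real \<Rightarrow> 'a \<Rightarrow> 'a" where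
  "curvature_operator \<omega> \<Gamma> \<tau> v =
     (let \<Delta> = derivative_lagrangian \<omega> \<Gamma> \<tau> in
        inv_into (\<Gamma> \<tau>) (blinfun_apply (chart_deriv \<Gamma> \<tau> \<Delta> 1))
          (blinfun_apply (chart_deriv \<Gamma> \<tau> \<Delta> 3) v))"

definition trace_on :: "'a::real_vector set \<Rightarrow> ('a \<Rightarrow> 'a) \<Rightarrow> real" where
  "trace_on S f =
     (let B = (SOME B. independent B \<and> span B = S) in \<Sum>b\<in>B. representation B (f b) b)"

definition projective ::
    "('a::euclidean_space \<Rightarrow> 'a \<Rightarrow> real) \<Rightarrow> real set \<Rightarrow> (real \<Rightarrow> 'a set) \<Rightarrow> bool" where
  "projective \<omega> J \<Gamma> \<longleftrightarrow> (\<forall>t\<in>J. trace_on (\<Gamma> t) (curvature_operator \<omega> \<Gamma> t) = 0)"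

end

theory Submission
  imports Defs
begin

text \<open>
  With \<open>e u = u + A u\<close> and \<open>f u = B u\<close>, the cycle consists of the subspaces
  \<open>{a e u + b f u | u \<in> \<Gamma>\<^sub>0}\<close>, \<open>[a : b] \<in> RP\<^sup>1\<close>. A linear change of the frame \<open>(e, f)\<close> makes any point of
  it the point \<open>[0 : 1]\<close> at infinity, so removing any point leaves an affine line, and a
  reparametrization of this line is a curve \<open>\<Gamma>(t) = {p u = e u + h(t) f u}\<close> with \<open>h' \<noteq> 0\<close>.

  In the chart of a transversal \<open>D\<close>, a curve is, up to a constant, the projection \<open>R(t)\<close> onto
  \<open>\<Gamma>(t)\<close> along \<open>D\<close>. Differentiating \<open>R (p u) = p u\<close> up to three times yields the derivatives of \<open>R\<close>.
  The second vanishes only for \<open>D = {f u - \<mu> p u}\<close> with \<open>\<mu> = h'' / (2 h'\<^sup>2)\<close>, and for this \<open>D\<close> the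
  third is the Schwarzian derivative of \<open>h\<close> times the first. Hence the curvature operator is a
  scalar, which vanishes with its trace.
\<close>

section \<open>Higher derivatives of curves\<close>

definition higher_differentiable_on ::
    "nat \<Rightarrow> real set \<Rightarrow> (real \<Rightarrow> 'b::real_normed_vector) \<Rightarrow> bool" where
  "higher_differentiable_on n U f \<longleftrightarrow> (\<forall>k<n. \<forall>t\<in>U. nth_deriv k f differentiable (at t))"

lemma smooth_on_iff_higher_differentiable_on:
  "smooth_on U f \<longleftrightarrow> (\<forall>n. higher_differentiable_on n U f)"
  unfolding smooth_on_def higher_differentiable_on_def by blast

lemma nth_deriv_0 [simp]: "nth_deriv 0 f = f"
  by (simp add: nth_deriv_def)

lemma nth_deriv_Suc: "nth_deriv (Suc k) f t = vector_derivative (nth_deriv k f) (at t)"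
  by (simp add: nth_deriv_def)

lemma nth_deriv_1: "nth_deriv 1 f t = vector_derivative f (at t)"
  by (simp add: nth_deriv_Suc)

lemma nth_deriv_Suc_shift: "nth_deriv (Suc k) f = nth_deriv k (\<lambda>t. vector_derivative f (at t))"
  by (simp add: nth_deriv_def funpow_Suc_right del: funpow.simps)

lemma higher_differentiable_on_0 [simp]: "higher_differentiable_on 0 U f"
  by (simp add: higher_differentiable_on_def)

lemma higher_differentiable_on_Suc:
  "higher_differentiable_on (Suc n) U f \<longleftrightarrow>
     (\<forall>t\<in>U. f differentiable (at t)) \<and>
     higher_differentiable_on n U (\<lambda>t. vector_derivative f (at t))"
  unfolding higher_differentiable_on_def All_less_Suc2 by (simp add: nth_deriv_Suc_shift)

lemma higher_differentiable_on_SucD: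
  "higher_differentiable_on (Suc n) U f \<Longrightarrow> higher_differentiable_on n U f"
  unfolding higher_differentiable_on_def by auto

lemma higher_differentiable_on_has_vector_derivative:
  assumes "higher_differentiable_on n U f" "k < n" "t \<in> U"
  shows "(nth_deriv k f has_vector_derivative nth_deriv (Suc k) f t) (at t)"
  using assms by (simp add: higher_differentiable_on_def nth_deriv_Suc vector_derivative_works)

lemma smooth_on_has_vector_derivative:
  "smooth_on U f \<Longrightarrow> t \<in> U \<Longrightarrow> (f has_vector_derivative vector_derivative f (at t)) (at t)"
  using higher_differentiable_on_has_vector_derivative[of 1 U f 0 t]
  by (simp add: smooth_on_iff_higher_differentiable_on nth_deriv_Suc)

lemma smooth_on_continuous_on: "smooth_on U f \<Longrightarrow> continuous_on U f"
  by (intro continuous_at_imp_continuous_on ballI)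
    (rule has_vector_derivative_continuous[OF smooth_on_has_vector_derivative])

lemma smooth_on_subset: "smooth_on U f \<Longrightarrow> V \<subseteq> U \<Longrightarrow> smooth_on V f"
  unfolding smooth_on_def by blast

lemma smooth_on_local:
  assumes "\<And>t. t \<in> U \<Longrightarrow> \<exists>V. t \<in> V \<and> smooth_on V f"
  shows "smooth_on U f"
  using assms unfolding smooth_on_def by meson

lemma
  assumes "open U" and f: "\<And>t. t \<in> U \<Longrightarrow> f t = D 0 t"
    and D: "\<And>k t. k < n \<Longrightarrow> t \<in> U \<Longrightarrow> (D k has_vector_derivative D (Suc k) t) (at t)"
  shows nth_deriv_eqI: "k \<le> n \<Longrightarrow> t \<in> U \<Longrightarrow> nth_deriv k f t = D k t"
    and higher_differentiable_onI: "higher_differentiable_on n U f"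
proof -
  have transfer: "(g has_vector_derivative D (Suc k) t) (at t)"
    if "k < n" "t \<in> U" "\<And>s. s \<in> U \<Longrightarrow> g s = D k s" for g k t
    by (rule has_vector_derivative_transform_within_open[OF D[OF that(1,2)] \<open>open U\<close> that(2)])
      (simp add: that(3))
  have nth_deriv: "nth_deriv k f t = D k t" if "k \<le> n" "t \<in> U" for k t
    using that
  proof (induction k arbitrary: t)
    case (Suc k)
    then have "(nth_deriv k f has_vector_derivative D (Suc k) t) (at t)"
      by (intro transfer) simp_all
    then show ?case by (simp add: nth_deriv_Suc vector_derivative_at)
  qed (simp add: f)
  then show "k \<le> n \<Longrightarrow> t \<in> U \<Longrightarrow> nth_deriv k f t = D k t" .
  show "higher_differentiable_on n U f"
    unfolding higher_differentiable_on_def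
    using transfer nth_deriv by (meson differentiableI_vector less_imp_le)
qed

lemma
  assumes "open U" "\<And>t. t \<in> U \<Longrightarrow> f t = g t" "higher_differentiable_on n U g"
  shows nth_deriv_cong: "k \<le> n \<Longrightarrow> t \<in> U \<Longrightarrow> nth_deriv k f t = nth_deriv k g t"
    and higher_differentiable_on_cong: "higher_differentiable_on n U f"
proof -
  let ?D = "\<lambda>k. nth_deriv k g"
  have f: "f t = ?D 0 t" if "t \<in> U" for t
    using assms(2) that by simp
  note D = higher_differentiable_on_has_vector_derivative[OF assms(3)]
  show "k \<le> n \<Longrightarrow> t \<in> U \<Longrightarrow> nth_deriv k f t = ?D k t"
    by (rule nth_deriv_eqI[where D = ?D, OF assms(1) f D])
  show "higher_differentiable_on n U f"
    by (rule higher_differentiable_onI[where D = ?D, OF assms(1) f D])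
qed

lemma smooth_on_cong:
  assumes "open U" "\<And>t. t \<in> U \<Longrightarrow> f t = g t" "smooth_on U g"
  shows "smooth_on U f"
  using higher_differentiable_on_cong[OF assms(1,2)] assms(3)
  by (simp add: smooth_on_iff_higher_differentiable_on)

lemma higher_differentiable_on_SucI:
  assumes "open U" "\<And>t. t \<in> U \<Longrightarrow> (f has_vector_derivative f' t) (at t)"
    "higher_differentiable_on n U f'"
  shows "higher_differentiable_on (Suc n) U f"
  unfolding higher_differentiable_on_Suc
proof
  show "\<forall>t\<in>U. f differentiable (at t)"
    using assms(2) differentiableI_vector by blast
  show "higher_differentiable_on n U (\<lambda>t. vector_derivative f (at t))"
    by (rule higher_differentiable_on_cong[OF assms(1) _ assms(3)])
      (rule vector_derivative_at[OF assms(2)])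
qed

lemma
  assumes "open U"
  shows nth_deriv_const: "t \<in> U \<Longrightarrow> nth_deriv k (\<lambda>t. c) t = (if k = 0 then c else 0)"
    and higher_differentiable_on_const: "higher_differentiable_on n U (\<lambda>t. c)"
proof -
  define D where "D k t = (if k = 0 then c else 0)" for k :: nat and t :: real
  have const: "c = D 0 t" for t
    by (simp add: D_def)
  have D: "(D k has_vector_derivative D (Suc k) t) (at t)" for k t
    unfolding D_def by simp
  show "nth_deriv k (\<lambda>t. c) t = (if k = 0 then c else 0)" if "t \<in> U"
    using nth_deriv_eqI[where D = D, OF assms const D order_refl that]
    by (simp add: D_def)
  show "higher_differentiable_on n U (\<lambda>t. c)"
    by (rule higher_differentiable_onI[where D = D, OF assms const D])
qed

lemma higher_differentiable_on_ident: "open U \<Longrightarrow> higher_differentiable_on n U (\<lambda>t. t)"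
proof (cases n)
  case (Suc m)
  assume "open U"
  then show ?thesis unfolding Suc
    by (intro higher_differentiable_on_SucI[where f' = "\<lambda>t. 1"] higher_differentiable_on_const) auto
qed simp

lemma
  assumes "open U" "higher_differentiable_on n U f" "higher_differentiable_on n U g"
  shows nth_deriv_add: "k \<le> n \<Longrightarrow> t \<in> U \<Longrightarrow>
      nth_deriv k (\<lambda>t. f t + g t) t = nth_deriv k f t + nth_deriv k g t"
    and higher_differentiable_on_add: "higher_differentiable_on n U (\<lambda>t. f t + g t)"
proof -
  let ?D = "\<lambda>k t. nth_deriv k f t + nth_deriv k g t"
  have D: "(?D k has_vector_derivative ?D (Suc k) t) (at t)" if "k < n" "t \<in> U" for k t
    using assms(2,3)[THEN higher_differentiable_on_has_vector_derivative, OF that]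
    by (rule has_vector_derivative_add)
  show "k \<le> n \<Longrightarrow> t \<in> U \<Longrightarrow> nth_deriv k (\<lambda>t. f t + g t) t = nth_deriv k f t + nth_deriv k g t"
    by (rule nth_deriv_eqI[where D = ?D and n = n, OF assms(1) _ D]) simp_all
  show "higher_differentiable_on n U (\<lambda>t. f t + g t)"
    by (rule higher_differentiable_onI[where D = ?D and n = n, OF assms(1) _ D]) simp_all
qed

context bounded_linear
begin

lemma
  assumes "open U" "higher_differentiable_on n U g"
  shows nth_deriv: "k \<le> n \<Longrightarrow> t \<in> U \<Longrightarrow> nth_deriv k (\<lambda>t. f (g t)) t = f (nth_deriv k g t)"
    and higher_differentiable_on: "higher_differentiable_on n U (\<lambda>t. f (g t))"
proof -
  let ?D = "\<lambda>k t. f (nth_deriv k g t)"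
  have D: "(?D k has_vector_derivative ?D (Suc k) t) (at t)" if "k < n" "t \<in> U" for k t
    using higher_differentiable_on_has_vector_derivative[OF assms(2) that]
    by (rule has_vector_derivative)
  show "k \<le> n \<Longrightarrow> t \<in> U \<Longrightarrow> nth_deriv k (\<lambda>t. f (g t)) t = f (nth_deriv k g t)"
    by (rule nth_deriv_eqI[where D = ?D and n = n, OF assms(1) _ D]) simp_all
  show "higher_differentiable_on n U (\<lambda>t. f (g t))"
    by (rule higher_differentiable_onI[where D = ?D and n = n, OF assms(1) _ D]) simp_all
qed

end

lemma sum_binomial_Suc:
  fixes a :: "nat \<Rightarrow> nat \<Rightarrow> 'b::real_vector"
  shows "(\<Sum>i\<le>k. real (k choose i) *\<^sub>R (a i (Suc (k - i)) + a (Suc i) (k - i))) =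
    (\<Sum>i\<le>Suc k. real (Suc k choose i) *\<^sub>R a i (Suc k - i))"
proof -
  have "(\<Sum>i\<le>Suc k. real (Suc k choose i) *\<^sub>R a i (Suc k - i)) =
      a 0 (Suc k) + (\<Sum>i\<le>k. real (Suc k choose Suc i) *\<^sub>R a (Suc i) (k - i))"
    by (subst sum.atMost_Suc_shift) simp
  also have "\<dots> = (\<Sum>i\<le>k. real (k choose i) *\<^sub>R a (Suc i) (k - i)) +
      (a 0 (Suc k) + (\<Sum>i\<le>k. real (k choose Suc i) *\<^sub>R a (Suc i) (k - i)))"
    by (simp add: sum.distrib scaleR_add_left)
  also have "a 0 (Suc k) + (\<Sum>i\<le>k. real (k choose Suc i) *\<^sub>R a (Suc i) (k - i)) =
      (\<Sum>i\<le>Suc k. real (k choose i) *\<^sub>R a i (Suc k - i))"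
    by (subst sum.atMost_Suc_shift) simp
  also have "\<dots> = (\<Sum>i\<le>k. real (k choose i) *\<^sub>R a i (Suc (k - i)))"
    by (simp add: Suc_diff_le)
  finally show ?thesis by (simp add: sum.distrib scaleR_add_right add.commute)
qed

context bounded_bilinear
begin

lemma
  assumes "open U" and f: "higher_differentiable_on n U f" and g: "higher_differentiable_on n U g"
  shows nth_deriv: "k \<le> n \<Longrightarrow> t \<in> U \<Longrightarrow> nth_deriv k (\<lambda>t. prod (f t) (g t)) t =
      (\<Sum>i\<le>k. real (k choose i) *\<^sub>R prod (nth_deriv i f t) (nth_deriv (k - i) g t))"
    and higher_differentiable_on: "higher_differentiable_on n U (\<lambda>t. prod (f t) (g t))"
proof -
  let ?D = "\<lambda>k t. \<Sum>i\<le>k. real (k choose i) *\<^sub>R prod (nth_deriv i f t) (nth_deriv (k - i) g t)"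
  have D: "(?D k has_vector_derivative ?D (Suc k) t) (at t)" if "k < n" "t \<in> U" for k t
  proof -
    have product: "((\<lambda>t. prod (nth_deriv i f t) (nth_deriv (k - i) g t)) has_vector_derivative
        prod (nth_deriv i f t) (nth_deriv (Suc (k - i)) g t) +
        prod (nth_deriv (Suc i) f t) (nth_deriv (k - i) g t)) (at t)" if "i \<in> {..k}" for i
      using that \<open>k < n\<close> \<open>t \<in> U\<close>
      by (intro has_vector_derivative higher_differentiable_on_has_vector_derivative[OF f]
          higher_differentiable_on_has_vector_derivative[OF g]) simp_all
    have "(?D k has_vector_derivative (\<Sum>i\<le>k. real (k choose i) *\<^sub>R
          (prod (nth_deriv i f t) (nth_deriv (Suc (k - i)) g t) +
           prod (nth_deriv (Suc i) f t) (nth_deriv (k - i) g t)))) (at t)"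
      by (intro has_vector_derivative_sum product
          bounded_linear.has_vector_derivative[OF bounded_linear_scaleR_right])
    then show ?thesis
      using sum_binomial_Suc[of k "\<lambda>i j. prod (nth_deriv i f t) (nth_deriv j g t)"] by argo
  qed
  show "k \<le> n \<Longrightarrow> t \<in> U \<Longrightarrow> nth_deriv k (\<lambda>t. prod (f t) (g t)) t = ?D k t"
    by (rule nth_deriv_eqI[where D = ?D and n = n, OF assms(1) _ D]) simp_all
  show "higher_differentiable_on n U (\<lambda>t. prod (f t) (g t))"
    by (rule higher_differentiable_onI[where D = ?D and n = n, OF assms(1) _ D]) simp_all
qed

end

lemma higher_differentiable_on_compose:
  fixes g :: "real \<Rightarrow> real"
  assumes "open U" "open V" "g ` U \<subseteq> V"
    and "higher_differentiable_on n V f" "higher_differentiable_on n U g"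
  shows "higher_differentiable_on n U (\<lambda>t. f (g t))"
  using assms(4,5)
proof (induction n arbitrary: f)
  case (Suc n)
  let ?f' = "\<lambda>t. vector_derivative f (at t)" and ?g' = "\<lambda>t. vector_derivative g (at t)"
  show ?case
  proof (rule higher_differentiable_on_SucI[OF assms(1)])
    fix t assume "t \<in> U"
    then have "g t \<in> V" using assms(3) by auto
    then have "((f \<circ> g) has_vector_derivative ?g' t *\<^sub>R ?f' (g t)) (at t)"
      using higher_differentiable_on_has_vector_derivative[OF Suc.prems(2), of 0]
        higher_differentiable_on_has_vector_derivative[OF Suc.prems(1), of 0] \<open>t \<in> U\<close>
      by (intro vector_diff_chain_at) (simp_all add: nth_deriv_Suc)
    then show "((\<lambda>t. f (g t)) has_vector_derivative ?g' t *\<^sub>R ?f' (g t)) (at t)"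
      by (simp add: o_def)
  next
    have "higher_differentiable_on n U ?g'" "higher_differentiable_on n V ?f'"
      using Suc.prems by (auto simp: higher_differentiable_on_Suc)
    then show "higher_differentiable_on n U (\<lambda>t. ?g' t *\<^sub>R ?f' (g t))"
      using higher_differentiable_on_SucD[OF Suc.prems(2)]
      by (intro bounded_bilinear.higher_differentiable_on[OF bounded_bilinear_scaleR] assms(1) Suc.IH)
  qed
qed simp

lemma smooth_on_const: "open U \<Longrightarrow> smooth_on U (\<lambda>t. c)"
  by (simp add: smooth_on_iff_higher_differentiable_on higher_differentiable_on_const)

lemma smooth_on_ident: "open U \<Longrightarrow> smooth_on U (\<lambda>t. t)"
  by (simp add: smooth_on_iff_higher_differentiable_on higher_differentiable_on_ident)

lemma smooth_on_add:
  "open U \<Longrightarrow> smooth_on U f \<Longrightarrow> smooth_on U g \<Longrightarrow> smooth_on U (\<lambda>t. f t + g t)"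
  by (simp add: smooth_on_iff_higher_differentiable_on higher_differentiable_on_add)

lemma (in bounded_linear) smooth_on:
  "open U \<Longrightarrow> smooth_on U g \<Longrightarrow> smooth_on U (\<lambda>t. f (g t))"
  by (simp add: smooth_on_iff_higher_differentiable_on higher_differentiable_on)

lemma smooth_on_compose:
  fixes g :: "real \<Rightarrow> real"
  shows "open U \<Longrightarrow> open V \<Longrightarrow> g ` U \<subseteq> V \<Longrightarrow> smooth_on V f \<Longrightarrow> smooth_on U g \<Longrightarrow>
    smooth_on U (\<lambda>t. f (g t))"
  by (simp add: smooth_on_iff_higher_differentiable_on higher_differentiable_on_compose)

lemma has_vector_derivative_iff_quotient:
  "(f has_vector_derivative f') (at t) \<longleftrightarrow> ((\<lambda>s. (f s - f t) /\<^sub>R (s - t)) \<longlongrightarrow> f') (at t)"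
proof -
  have "(f has_vector_derivative f') (at t) \<longleftrightarrow>
      ((\<lambda>s. (f s - f t - (s - t) *\<^sub>R f') /\<^sub>R norm (s - t)) \<longlongrightarrow> 0) (at t)"
    by (simp add: has_vector_derivative_def has_derivative_at_within bounded_linear_scaleR_left)
  also have "\<dots> \<longleftrightarrow> ((\<lambda>s. (f s - f t) /\<^sub>R (s - t) - f') \<longlongrightarrow> 0) (at t)"
  proof (subst (1 2) tendsto_norm_zero_iff[symmetric], rule tendsto_cong)
    show "\<forall>\<^sub>F s in at t. norm ((f s - f t - (s - t) *\<^sub>R f') /\<^sub>R norm (s - t)) =
        norm ((f s - f t) /\<^sub>R (s - t) - f')"
      unfolding eventually_at_filter
    proof (intro always_eventually allI impI)
      fix s assume "s \<noteq> t"
      then have "(f s - f t) /\<^sub>R (s - t) - f' = (f s - f t - (s - t) *\<^sub>R f') /\<^sub>R (s - t)"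
        by (simp add: scaleR_diff_right)
      then show "norm ((f s - f t - (s - t) *\<^sub>R f') /\<^sub>R norm (s - t)) =
          norm ((f s - f t) /\<^sub>R (s - t) - f')" by simp
    qed
  qed
  also have "\<dots> \<longleftrightarrow> ((\<lambda>s. (f s - f t) /\<^sub>R (s - t)) \<longlongrightarrow> f') (at t)"
    by (simp add: LIM_zero_iff)
  finally show ?thesis .
qed

section \<open>Projections along a subspace\<close>

definition complementary :: "'a::euclidean_space set \<Rightarrow> 'a set \<Rightarrow> bool" where
  "complementary S T \<longleftrightarrow> subspace S \<and> subspace T \<and> S \<inter> T = {0} \<and> dim S + dim T = DIM('a)"

definition projection_along :: "'a::euclidean_space set \<Rightarrow> 'a set \<Rightarrow> ('a \<Rightarrow>\<^sub>L 'a)" where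
  "projection_along S T = (SOME P. \<forall>w. blinfun_apply P w \<in> S \<and> w - P w \<in> T)"

lemma complementaryD:
  fixes S T :: "'a::euclidean_space set"
  assumes "complementary S T"
  shows "subspace S" "subspace T" "S \<inter> T = {0}" "dim S + dim T = DIM('a)"
  using assms by (auto simp: complementary_def)

lemma complementary_sym: "complementary S T \<Longrightarrow> complementary T S"
  by (auto simp: complementary_def)

lemma complementary_add_eq_0:
  assumes "complementary S T" "u \<in> S" "v \<in> T" "u + v = 0"
  shows "u = 0"
proof -
  note ST = complementaryD[OF assms(1)]
  have "u = - v" using assms(4) by (simp add: eq_neg_iff_add_eq_0)
  then have "u \<in> S \<inter> T" using assms(2) subspace_neg[OF ST(2) assms(3)] by simp
  then show ?thesis unfolding ST(3) by simp
qed

lemma complementary_component_unique: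
  assumes "complementary S T" "a \<in> S" "b \<in> S" "w - a \<in> T" "w - b \<in> T"
  shows "a = b"
proof -
  note ST = complementaryD[OF assms(1)]
  have "a - b = 0"
    by (rule complementary_add_eq_0[OF assms(1) subspace_diff[OF ST(1) assms(2,3)]
          subspace_diff[OF ST(2) assms(4,5)]]) simp
  then show ?thesis by simp
qed

lemma complementary_component_exists:
  fixes S T :: "'a::euclidean_space set"
  assumes "complementary S T"
  shows "\<exists>a\<in>S. w - a \<in> T"
proof -
  note ST = complementaryD[OF assms]
  let ?sum = "{x + y |x y. x \<in> S \<and> y \<in> T}"
  have "dim ?sum = DIM('a)"
    using dim_sums_Int[OF ST(1,2)] ST(3,4) by simp
  then have "span ?sum = UNIV"
    by (simp add: dim_eq_full)
  then have "w \<in> ?sum"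
    using span_eq_iff[THEN iffD2, OF subspace_sums[OF ST(1,2)]] by simp
  then obtain x y where "w = x + y" "x \<in> S" "y \<in> T" by blast
  then show ?thesis by (intro bexI[of _ x]) simp_all
qed

lemma projection_along_exists:
  fixes S T :: "'a::euclidean_space set"
  assumes "complementary S T"
  shows "\<exists>P :: 'a \<Rightarrow>\<^sub>L 'a. \<forall>w. P w \<in> S \<and> w - P w \<in> T"
proof -
  note ST = complementaryD[OF assms]
  obtain p where p: "p w \<in> S" "w - p w \<in> T" for w
    using complementary_component_exists[OF assms] by metis
  have "linear p"
  proof
    show "p (v + w) = p v + p w" for v w
    proof (rule complementary_component_unique[OF assms])
      show "v + w - (p v + p w) \<in> T"
        unfolding add_diff_add by (rule subspace_add[OF ST(2) p(2) p(2)])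
    qed (simp_all add: p ST(1) subspace_add)
    show "p (r *\<^sub>R w) = r *\<^sub>R p w" for r w
    proof (rule complementary_component_unique[OF assms])
      show "r *\<^sub>R w - r *\<^sub>R p w \<in> T"
        using subspace_scale[OF ST(2) p(2)[of w], of r] by (simp add: scaleR_diff_right)
    qed (simp_all add: p ST(1) subspace_scale)
  qed
  then have "blinfun_apply (Blinfun p) = p"
    by (simp add: bounded_linear_Blinfun_apply linear_conv_bounded_linear)
  then show ?thesis
    by (intro exI[of _ "Blinfun p"]) (simp add: p)
qed

lemma
  assumes "complementary S T"
  shows projection_along_in: "projection_along S T w \<in> S"
    and diff_projection_along_in: "w - projection_along S T w \<in> T"
  using someI_ex[OF projection_along_exists[OF assms]] unfolding projection_along_def by auto

lemma projection_along_eqI: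
  assumes "complementary S T" "v \<in> S" "w - v \<in> T"
  shows "projection_along S T w = v"
  by (rule complementary_component_unique[OF assms(1) projection_along_in[OF assms(1)] assms(2)
        diff_projection_along_in[OF assms(1)] assms(3)])

lemma projection_along_ident: "complementary S T \<Longrightarrow> w \<in> S \<Longrightarrow> projection_along S T w = w"
  by (rule projection_along_eqI) (auto simp: complementary_def subspace_0)

lemma projection_along_eq_0: "complementary S T \<Longrightarrow> w \<in> T \<Longrightarrow> projection_along S T w = 0"
  by (rule projection_along_eqI) (auto simp: complementary_def subspace_0)

lemma projection_along_diff_eq_0:
  assumes "complementary S T" "complementary S' T"
  shows "projection_along S' T (w - projection_along S T w) = 0"
  by (rule projection_along_eq_0[OF assms(2) diff_projection_along_in[OF assms(1)]])

text \<open>Infinitesimally, the projection \<open>R\<close> along \<open>D\<close> solves the Riccati equation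
  \<open>R' = (1 - R) P' R\<close> driven by the projection \<open>P\<close> along \<open>T\<close>; this is why the transition maps
  between graph charts are smooth.\<close>

lemma projection_along_change_direction:
  assumes "complementary S T" "complementary S' T" "complementary S D" "complementary S' D"
  shows "projection_along S' D - projection_along S D =
    (id_blinfun - projection_along S' D) o\<^sub>L (projection_along S' T - projection_along S T) o\<^sub>L
      projection_along S D"
proof (rule blinfun_eqI)
  fix w
  let ?v = "projection_along S D w"
  have "projection_along S' D w = projection_along S' D ?v"
    using projection_along_diff_eq_0[OF assms(3,4), of w] by (simp add: blinfun.diff_right)
  moreover have "projection_along S T ?v = ?v"
    by (rule projection_along_ident[OF assms(1) projection_along_in[OF assms(3)]])
  moreover have "projection_along S' D (projection_along S' T ?v) = projection_along S' T ?v"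
    by (rule projection_along_ident[OF assms(4) projection_along_in[OF assms(2)]])
  ultimately show "(projection_along S' D - projection_along S D) w =
    ((id_blinfun - projection_along S' D) o\<^sub>L (projection_along S' T - projection_along S T) o\<^sub>L
      projection_along S D) w"
    by (simp add: blinfun.bilinear_simps)
qed

lemma norm_projection_along_diff_le:
  fixes S S' T D :: "'a::euclidean_space set"
  assumes "complementary S T" "complementary S' T" "complementary S D" "complementary S' D"
  defines "\<delta> \<equiv> norm (projection_along S' T - projection_along S T) * norm (projection_along S D)"
  shows "norm (projection_along S' D - projection_along S D) \<le>
    (1 + norm (projection_along S D) + norm (projection_along S' D - projection_along S D)) * \<delta>"
proof -
  let ?R = "projection_along S D" and ?R' = "projection_along S' D"
  have "norm (id_blinfun - ?R') \<le> norm (id_blinfun :: 'a \<Rightarrow>\<^sub>L 'a) + norm ?R'"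
    by (rule norm_triangle_ineq4)
  also have "\<dots> \<le> 1 + (norm ?R + norm (?R' - ?R))"
    by (intro add_mono norm_blinfun_id_le norm_triangle_sub)
  finally have Q: "norm (id_blinfun - ?R') \<le> 1 + norm ?R + norm (?R' - ?R)"
    by (simp only: add.assoc)
  have "norm (?R' - ?R) \<le>
      norm (id_blinfun - ?R') * norm (projection_along S' T - projection_along S T) * norm ?R"
    unfolding projection_along_change_direction[OF assms(1-4)]
    by (rule order_trans[OF norm_blinfun_compose mult_right_mono[OF norm_blinfun_compose]]) simp
  also have "\<dots> = norm (id_blinfun - ?R') * \<delta>"
    by (simp add: \<delta>_def)
  also have "\<dots> \<le> (1 + norm ?R + norm (?R' - ?R)) * \<delta>"
    using Q by (rule mult_right_mono) (simp add: \<delta>_def)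
  finally show ?thesis .
qed

lemma norm_le_of_in_complement:
  assumes "complementary S T" "complementary S' T" "complementary S D" "w \<in> S'" "w \<in> D"
  shows "norm w \<le> norm (id_blinfun - projection_along S D) *
    norm (projection_along S' T - projection_along S T) * norm w"
proof -
  let ?P = "projection_along S T" and ?P' = "projection_along S' T"
  let ?Q = "id_blinfun - projection_along S D"
  have "?P' w = w"
    by (rule projection_along_ident[OF assms(2,4)])
  moreover have "?Q w = w" "?Q (?P w) = 0"
    using projection_along_eq_0[OF assms(3,5)]
      projection_along_ident[OF assms(3) projection_along_in[OF assms(1)]]
    by (simp_all add: blinfun.diff_left)
  ultimately have "w = (?Q o\<^sub>L (?P' - ?P)) w"
    by (simp add: blinfun.diff_left blinfun.diff_right)
  then have "norm w \<le> norm (?Q o\<^sub>L (?P' - ?P)) * norm w"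
    by (metis norm_blinfun)
  also have "\<dots> \<le> norm ?Q * norm (?P' - ?P) * norm w"
    by (intro mult_right_mono norm_blinfun_compose) simp
  finally show ?thesis .
qed

lemma complementary_open:
  fixes S :: "'b::topological_space \<Rightarrow> 'a::euclidean_space set"
  assumes "open U" "t \<in> U" and T: "\<And>s. s \<in> U \<Longrightarrow> complementary (S s) T"
    and cont: "continuous_on U (\<lambda>s. projection_along (S s) T)"
    and D: "complementary (S t) D"
  obtains V where "open V" "t \<in> V" "V \<subseteq> U" "\<And>s. s \<in> V \<Longrightarrow> complementary (S s) D"
proof -
  let ?P = "\<lambda>s. projection_along (S s) T" and ?Q = "id_blinfun - projection_along (S t) D"
  define V where "V = U \<inter> (\<lambda>s. norm ?Q * norm (?P s - ?P t)) -` {..<1}"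
  have "open V"
    unfolding V_def by (intro continuous_open_preimage continuous_intros cont assms(1) open_lessThan)
  moreover have "complementary (S s) D" if "s \<in> V" for s
  proof -
    have s: "s \<in> U" "norm ?Q * norm (?P s - ?P t) < 1"
      using that by (auto simp: V_def)
    have "w = 0" if "w \<in> S s" "w \<in> D" for w
    proof -
      have "(1 - norm ?Q * norm (?P s - ?P t)) * norm w \<le> 0"
        using norm_le_of_in_complement[OF T[OF assms(2)] T[OF s(1)] D that]
        by (simp add: algebra_simps)
      then show ?thesis using s(2) by (simp add: mult_le_0_iff)
    qed
    then show ?thesis
      using complementaryD[OF T[OF s(1)]] complementaryD[OF D] complementaryD(4)[OF T[OF assms(2)]]
      unfolding complementary_def by (auto simp: subspace_0)
  qed
  ultimately show ?thesis
    using that[of V] assms(2) by (simp add: V_def)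
qed

lemma continuous_on_projection_along:
  fixes S :: "'b::topological_space \<Rightarrow> 'a::euclidean_space set"
  assumes T: "\<And>s. s \<in> U \<Longrightarrow> complementary (S s) T" and D: "\<And>s. s \<in> U \<Longrightarrow> complementary (S s) D"
    and cont: "continuous_on U (\<lambda>s. projection_along (S s) T)"
  shows "continuous_on U (\<lambda>s. projection_along (S s) D)"
  unfolding continuous_on_def
proof
  fix t assume t: "t \<in> U"
  let ?F = "at t within U"
  let ?P = "\<lambda>s. projection_along (S s) T" and ?R = "\<lambda>s. projection_along (S s) D"
  define \<delta> where "\<delta> s = norm (?P s - ?P t) * norm (?R t)" for s
  have "((\<lambda>s. norm (?P s - ?P t) * norm (?R t)) \<longlongrightarrow> norm (?P t - ?P t) * norm (?R t)) ?F"
    using cont t by (intro tendsto_intros) (simp add: continuous_on_def)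
  then have \<delta>: "(\<delta> \<longlongrightarrow> 0) ?F"
    by (simp add: \<delta>_def[abs_def])
  have "\<forall>\<^sub>F s in ?F. \<delta> s < 1 / 2 \<and> s \<in> U"
    using order_tendstoD(2)[OF \<delta>, of "1 / 2"] by (auto simp: eventually_at_topological)
  then have "\<forall>\<^sub>F s in ?F. norm (?R s - ?R t) \<le> 2 * (1 + norm (?R t)) * \<delta> s"
  proof (rule eventually_mono)
    fix s assume s: "\<delta> s < 1 / 2 \<and> s \<in> U"
    then have "norm (?R s - ?R t) * \<delta> s \<le> norm (?R s - ?R t) * (1 / 2)"
      by (intro mult_left_mono) auto
    then show "norm (?R s - ?R t) \<le> 2 * (1 + norm (?R t)) * \<delta> s"
      using norm_projection_along_diff_le[OF T[OF t] T D[OF t] D, of s] s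
      by (simp add: \<delta>_def algebra_simps)
  qed
  moreover have "((\<lambda>s. 2 * (1 + norm (?R t)) * \<delta> s) \<longlongrightarrow> 0) ?F"
    using tendsto_mult_left[OF \<delta>] by simp
  ultimately have "((\<lambda>s. ?R s - ?R t) \<longlongrightarrow> 0) ?F"
    by (rule Lim_null_comparison)
  then show "(?R \<longlongrightarrow> ?R t) ?F" by (simp add: LIM_zero_iff)
qed

lemma has_vector_derivative_projection_along:
  fixes S :: "real \<Rightarrow> 'a::euclidean_space set"
  assumes "open U" "t \<in> U"
    and T: "\<And>s. s \<in> U \<Longrightarrow> complementary (S s) T" and D: "\<And>s. s \<in> U \<Longrightarrow> complementary (S s) D"
    and cont: "continuous_on U (\<lambda>s. projection_along (S s) T)"
    and P': "((\<lambda>s. projection_along (S s) T) has_vector_derivative P') (at t)"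
  shows "((\<lambda>s. projection_along (S s) D) has_vector_derivative
    (id_blinfun - projection_along (S t) D) o\<^sub>L P' o\<^sub>L projection_along (S t) D) (at t)"
  unfolding has_vector_derivative_iff_quotient
proof (rule Lim_transform_within_open[OF _ assms(1,2)])
  let ?P = "\<lambda>s. projection_along (S s) T" and ?R = "\<lambda>s. projection_along (S s) D"
  note compose = bounded_bilinear.tendsto[OF bounded_bilinear_blinfun_compose]
  have "continuous_on U ?R"
    by (rule continuous_on_projection_along[where S = S, OF T D cont])
  then have R: "(?R \<longlongrightarrow> ?R t) (at t)"
    using assms(1,2) by (simp add: continuous_on_eq_continuous_at continuous_at)
  show "((\<lambda>s. (id_blinfun - ?R s) o\<^sub>L ((?P s - ?P t) /\<^sub>R (s - t)) o\<^sub>L ?R t) \<longlongrightarrow>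
      (id_blinfun - ?R t) o\<^sub>L P' o\<^sub>L ?R t) (at t)"
    by (rule compose[OF compose[OF tendsto_diff[OF tendsto_const R]
        P'[unfolded has_vector_derivative_iff_quotient]] tendsto_const])
  show "(id_blinfun - ?R s) o\<^sub>L ((?P s - ?P t) /\<^sub>R (s - t)) o\<^sub>L ?R t = (?R s - ?R t) /\<^sub>R (s - t)"
    if "s \<in> U" "s \<noteq> t" for s
    unfolding projection_along_change_direction[OF T[OF assms(2)] T[OF that(1)]
      D[OF assms(2)] D[OF that(1)]]
    by (rule blinfun_eqI) (simp add: blinfun.bilinear_simps)
qed

lemma smooth_on_projection_along:
  fixes S :: "real \<Rightarrow> 'a::euclidean_space set"
  assumes "open U"
    and T: "\<And>s. s \<in> U \<Longrightarrow> complementary (S s) T" and D: "\<And>s. s \<in> U \<Longrightarrow> complementary (S s) D"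
    and smooth: "smooth_on U (\<lambda>s. projection_along (S s) T)"
  shows "smooth_on U (\<lambda>s. projection_along (S s) D)"
proof -
  let ?P = "\<lambda>s. projection_along (S s) T" and ?R = "\<lambda>s. projection_along (S s) D"
  let ?P' = "\<lambda>s. vector_derivative ?P (at s)"
  have R': "(?R has_vector_derivative (id_blinfun + - ?R s) o\<^sub>L ?P' s o\<^sub>L ?R s) (at s)"
    if "s \<in> U" for s
    using has_vector_derivative_projection_along[where S = S, OF assms(1) that T D
      smooth_on_continuous_on[OF smooth] smooth_on_has_vector_derivative[OF smooth that]]
    by simp
  have "higher_differentiable_on n U ?R" for n
  proof (induction n)
    case (Suc n)
    have "higher_differentiable_on n U ?P'"
      using smooth higher_differentiable_on_Suc[of n U ?P]
      by (simp add: smooth_on_iff_higher_differentiable_on)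
    with Suc have derivative: "higher_differentiable_on n U
        (\<lambda>s. (id_blinfun + - ?R s) o\<^sub>L ?P' s o\<^sub>L ?R s)"
      by (intro bounded_bilinear.higher_differentiable_on[OF bounded_bilinear_blinfun_compose]
          higher_differentiable_on_add higher_differentiable_on_const assms(1)
          bounded_linear.higher_differentiable_on[OF bounded_linear_minus[OF bounded_linear_ident]])
    show ?case
      by (rule higher_differentiable_on_SucI[OF assms(1) _ derivative]) (rule R')
  qed simp
  then show ?thesis by (simp add: smooth_on_iff_higher_differentiable_on)
qed

section \<open>Curves of Lagrangian subspaces\<close>

lemma lagrangianD:
  fixes \<omega> :: "'a::euclidean_space \<Rightarrow> 'a \<Rightarrow> real"
  assumes "\<Lambda> \<in> lagrangian_grassmannian \<omega>"
  shows "subspace \<Lambda>" "\<And>u v. u \<in> \<Lambda> \<Longrightarrow> v \<in> \<Lambda> \<Longrightarrow> \<omega> u v = 0" "2 * dim \<Lambda> = DIM('a)"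
  using assms by (auto simp: lagrangian_grassmannian_def)

lemma dim_lagrangian_pos:
  fixes \<omega> :: "'a::euclidean_space \<Rightarrow> 'a \<Rightarrow> real"
  assumes "\<Lambda> \<in> lagrangian_grassmannian \<omega>"
  shows "dim \<Lambda> > 0"
  using lagrangianD(3)[OF assms] DIM_positive[where 'a='a] by linarith

lemma transversals_iff_complementary:
  fixes \<omega> :: "'a::euclidean_space \<Rightarrow> 'a \<Rightarrow> real"
  assumes "\<Delta> \<in> lagrangian_grassmannian \<omega>"
  shows "\<Gamma> \<in> transversals \<omega> \<Delta> \<longleftrightarrow> \<Gamma> \<in> lagrangian_grassmannian \<omega> \<and> complementary \<Gamma> \<Delta>"
proof -
  have "dim \<Gamma> + dim \<Delta> = DIM('a)" if "\<Gamma> \<in> lagrangian_grassmannian \<omega>"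
    using lagrangianD(3)[OF assms] lagrangianD(3)[OF that] by linarith
  then show ?thesis
    unfolding transversals_def complementary_def
    using lagrangianD(1)[OF assms] lagrangianD(1) by blast
qed

lemma lin_mapsD:
  assumes "A \<in> lin_maps \<Delta>"
  shows "blinfun_apply A w \<in> \<Delta>" "w \<in> \<Delta> \<Longrightarrow> blinfun_apply A w = 0"
  using assms by (auto simp: lin_maps_def)

lemma projection_along_graph_over:
  assumes "complementary \<Gamma>\<^sub>0 \<Delta>" "complementary (graph_over \<Gamma>\<^sub>0 A) \<Delta>" "A \<in> lin_maps \<Delta>"
  shows "projection_along (graph_over \<Gamma>\<^sub>0 A) \<Delta> = projection_along \<Gamma>\<^sub>0 \<Delta> + A"
proof (rule blinfun_eqI, rule projection_along_eqI[OF assms(2)])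
  fix w
  let ?u = "projection_along \<Gamma>\<^sub>0 \<Delta> w"
  have "A (w - ?u) = 0"
    using lin_mapsD(2)[OF assms(3)] diff_projection_along_in[OF assms(1)] by blast
  then have "(projection_along \<Gamma>\<^sub>0 \<Delta> + A) w = ?u + A ?u"
    by (simp add: blinfun.bilinear_simps)
  then show "(projection_along \<Gamma>\<^sub>0 \<Delta> + A) w \<in> graph_over \<Gamma>\<^sub>0 A"
    using projection_along_in[OF assms(1)] unfolding graph_over_def by blast
  have "(w - ?u) - A w \<in> \<Delta>"
    by (intro subspace_diff complementaryD(2)[OF assms(1)] diff_projection_along_in[OF assms(1)]
        lin_mapsD(1)[OF assms(3)])
  then show "w - (projection_along \<Gamma>\<^sub>0 \<Delta> + A) w \<in> \<Delta>"
    by (simp add: blinfun.add_left algebra_simps)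
qed

lemma graph_over_projection_along_diff:
  assumes "complementary \<Gamma>\<^sub>0 \<Delta>" "complementary \<Gamma> \<Delta>"
  shows "graph_over \<Gamma>\<^sub>0 (projection_along \<Gamma> \<Delta> - projection_along \<Gamma>\<^sub>0 \<Delta>) = \<Gamma>"
proof -
  let ?P = "projection_along \<Gamma>\<^sub>0 \<Delta>" and ?Q = "projection_along \<Gamma> \<Delta>"
  have "graph_over \<Gamma>\<^sub>0 (?Q - ?P) = ?Q ` \<Gamma>\<^sub>0"
    unfolding graph_over_def
    by (intro image_cong) (simp_all add: blinfun.diff_left projection_along_ident[OF assms(1)])
  also have "\<dots> = \<Gamma>"
  proof (intro equalityI subsetI)
    fix v assume "v \<in> \<Gamma>"
    then have "v = ?Q (?P v)"
      using projection_along_diff_eq_0[OF assms, of v] projection_along_ident[OF assms(2)]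
      by (simp add: blinfun.diff_right)
    then show "v \<in> ?Q ` \<Gamma>\<^sub>0" using projection_along_in[OF assms(1)] by blast
  qed (use projection_along_in[OF assms(2)] in auto)
  finally show ?thesis .
qed

text \<open>In this form the affine structure on the transversals of \<open>\<Delta>\<close> visibly does not depend on the
  origin \<open>\<Gamma>\<^sub>0\<close>.\<close>

lemma graph_chart_eq_projection_along_diff:
  assumes "complementary \<Gamma>\<^sub>0 \<Delta>" "complementary \<Gamma> \<Delta>"
  shows "graph_chart \<Gamma>\<^sub>0 \<Delta> \<Gamma> = projection_along \<Gamma> \<Delta> - projection_along \<Gamma>\<^sub>0 \<Delta>"
  unfolding graph_chart_def
proof (rule the_equality)
  let ?A = "projection_along \<Gamma> \<Delta> - projection_along \<Gamma>\<^sub>0 \<Delta>"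
  have "(w - projection_along \<Gamma>\<^sub>0 \<Delta> w) - (w - projection_along \<Gamma> \<Delta> w) \<in> \<Delta>" for w
    by (intro subspace_diff complementaryD(2)[OF assms(1)] diff_projection_along_in assms)
  then have "?A \<in> lin_maps \<Delta>"
    by (simp add: lin_maps_def blinfun.diff_left projection_along_eq_0[OF assms(1)]
        projection_along_eq_0[OF assms(2)])
  then show "?A \<in> lin_maps \<Delta> \<and> \<Gamma> = graph_over \<Gamma>\<^sub>0 ?A"
    using graph_over_projection_along_diff[OF assms] by simp
  show "A = ?A" if "A \<in> lin_maps \<Delta> \<and> \<Gamma> = graph_over \<Gamma>\<^sub>0 A" for A
    using projection_along_graph_over[OF assms(1), of A] assms(2) that by simp
qed

lemma smooth_lagrangian_curveI:
  fixes \<omega> :: "'a::euclidean_space \<Rightarrow> 'a \<Rightarrow> real"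
  assumes "open I" "\<Delta> \<in> lagrangian_grassmannian \<omega>" "\<And>t. t \<in> I \<Longrightarrow> \<Gamma> t \<in> transversals \<omega> \<Delta>"
    and smooth: "smooth_on I (\<lambda>t. projection_along (\<Gamma> t) \<Delta>)"
  shows "smooth_lagrangian_curve \<omega> I \<Gamma>"
proof -
  have compl: "complementary (\<Gamma> t) \<Delta>" if "t \<in> I" for t
    using assms(3)[OF that] transversals_iff_complementary[OF assms(2)] by blast
  have "smooth_on I (\<lambda>t. graph_chart (\<Gamma> \<tau>) \<Delta> (\<Gamma> t))" if "\<tau> \<in> I" for \<tau>
  proof (rule smooth_on_cong[OF assms(1)])
    show "smooth_on I (\<lambda>t. projection_along (\<Gamma> t) \<Delta> + - projection_along (\<Gamma> \<tau>) \<Delta>)"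
      by (intro smooth_on_add smooth_on_const smooth assms(1))
    show "graph_chart (\<Gamma> \<tau>) \<Delta> (\<Gamma> t) = projection_along (\<Gamma> t) \<Delta> + - projection_along (\<Gamma> \<tau>) \<Delta>"
      if "t \<in> I" for t
      using graph_chart_eq_projection_along_diff[OF compl[OF \<open>\<tau> \<in> I\<close>] compl[OF that]] by simp
  qed
  moreover have "\<Gamma> t \<in> lagrangian_grassmannian \<omega>" if "t \<in> I" for t
    using assms(3)[OF that] by (simp add: transversals_def)
  ultimately show ?thesis
    unfolding smooth_lagrangian_curve_def using assms(1-3) by blast
qed

lemma smooth_lagrangian_curve_projection_along:
  fixes \<omega> :: "'a::euclidean_space \<Rightarrow> 'a \<Rightarrow> real"
  assumes "smooth_lagrangian_curve \<omega> I \<Gamma>" "\<tau> \<in> I" "complementary (\<Gamma> \<tau>) D"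
  obtains V where "open V" "\<tau> \<in> V" "V \<subseteq> I" "\<And>t. t \<in> V \<Longrightarrow> complementary (\<Gamma> t) D"
    "smooth_on V (\<lambda>t. projection_along (\<Gamma> t) D)"
proof -
  obtain \<Delta> \<Gamma>\<^sub>0 U where \<Delta>: "\<Delta> \<in> lagrangian_grassmannian \<omega>" and \<Gamma>\<^sub>0: "\<Gamma>\<^sub>0 \<in> transversals \<omega> \<Delta>"
    and U: "U \<subseteq> I" "open U" "\<tau> \<in> U" and \<Gamma>: "\<forall>t\<in>U. \<Gamma> t \<in> transversals \<omega> \<Delta>"
    and chart: "smooth_on U (\<lambda>t. graph_chart \<Gamma>\<^sub>0 \<Delta> (\<Gamma> t))"
    using assms(1,2) unfolding smooth_lagrangian_curve_def by meson
  have compl\<^sub>0: "complementary \<Gamma>\<^sub>0 \<Delta>" and compl: "\<And>t. t \<in> U \<Longrightarrow> complementary (\<Gamma> t) \<Delta>"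
    using \<Gamma>\<^sub>0 \<Gamma> transversals_iff_complementary[OF \<Delta>] by auto
  have smooth: "smooth_on U (\<lambda>t. projection_along (\<Gamma> t) \<Delta>)"
  proof (rule smooth_on_cong[OF U(2)])
    show "smooth_on U (\<lambda>t. graph_chart \<Gamma>\<^sub>0 \<Delta> (\<Gamma> t) + projection_along \<Gamma>\<^sub>0 \<Delta>)"
      by (intro smooth_on_add smooth_on_const chart U(2))
    show "projection_along (\<Gamma> t) \<Delta> = graph_chart \<Gamma>\<^sub>0 \<Delta> (\<Gamma> t) + projection_along \<Gamma>\<^sub>0 \<Delta>" if "t \<in> U" for t
      using graph_chart_eq_projection_along_diff[OF compl\<^sub>0 compl[OF that]] by simp
  qed
  obtain V where V: "open V" "\<tau> \<in> V" "V \<subseteq> U" "\<And>t. t \<in> V \<Longrightarrow> complementary (\<Gamma> t) D"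
    using complementary_open[where S = \<Gamma>, OF U(2,3) compl smooth_on_continuous_on[OF smooth] assms(3)]
    by blast
  moreover have "smooth_on V (\<lambda>t. projection_along (\<Gamma> t) D)"
    using V(3) compl smooth_on_subset[OF smooth V(3)]
    by (intro smooth_on_projection_along[of V \<Gamma> \<Delta> D] V) auto
  ultimately show ?thesis using that[of V] U(1) by blast
qed

lemma chart_deriv_eq_nth_deriv_projection_along:
  assumes "open V" "\<tau> \<in> V" and compl: "\<And>t. t \<in> V \<Longrightarrow> complementary (\<Gamma> t) D"
    and smooth: "smooth_on V (\<lambda>t. projection_along (\<Gamma> t) D)" and "k > 0"
  shows "chart_deriv \<Gamma> \<tau> D k = nth_deriv k (\<lambda>t. projection_along (\<Gamma> t) D) \<tau>"
proof -
  let ?R = "\<lambda>t. projection_along (\<Gamma> t) D"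
  have diff: "higher_differentiable_on k V ?R" "higher_differentiable_on k V (\<lambda>t. - ?R \<tau>)"
    using smooth assms(1)
    by (simp_all add: smooth_on_iff_higher_differentiable_on higher_differentiable_on_const)
  have "chart_deriv \<Gamma> \<tau> D k = nth_deriv k (\<lambda>t. ?R t + - ?R \<tau>) \<tau>"
    unfolding chart_deriv_def
    by (rule nth_deriv_cong[OF assms(1) _ higher_differentiable_on_add[OF assms(1) diff]
          order_refl assms(2)])
      (simp add: graph_chart_eq_projection_along_diff[OF compl[OF assms(2)] compl])
  also have "\<dots> = nth_deriv k ?R \<tau> + nth_deriv k (\<lambda>t. - ?R \<tau>) \<tau>"
    by (rule nth_deriv_add[OF assms(1) diff order_refl assms(2)])
  finally show ?thesis
    using \<open>k > 0\<close> by (simp add: nth_deriv_const[OF assms(1,2)])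
qed

lemma chart_deriv_eq_0:
  assumes "smooth_lagrangian_curve \<omega> I \<Gamma>" "\<tau> \<in> I" "complementary (\<Gamma> \<tau>) D" "k > 0" "w \<in> D"
  shows "chart_deriv \<Gamma> \<tau> D k w = 0"
proof -
  obtain V where V: "open V" "\<tau> \<in> V" "V \<subseteq> I" "\<And>t. t \<in> V \<Longrightarrow> complementary (\<Gamma> t) D"
    and smooth: "smooth_on V (\<lambda>t. projection_along (\<Gamma> t) D)"
    using smooth_lagrangian_curve_projection_along[OF assms(1-3)] by blast
  have "chart_deriv \<Gamma> \<tau> D k w = nth_deriv k (\<lambda>t. projection_along (\<Gamma> t) D) \<tau> w"
    using chart_deriv_eq_nth_deriv_projection_along[OF V(1,2) V(4) smooth assms(4)] by simp
  also have "\<dots> = nth_deriv k (\<lambda>t. projection_along (\<Gamma> t) D w) \<tau>"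
    using smooth unfolding smooth_on_iff_higher_differentiable_on
    by (intro bounded_linear.nth_deriv[OF blinfun.bounded_linear_left V(1) _ order_refl V(2), symmetric])
      (rule spec)
  also have "\<dots> = nth_deriv k (\<lambda>t. 0) \<tau>"
    by (rule nth_deriv_cong[OF V(1) _ higher_differentiable_on_const[OF V(1)] order_refl V(2)])
      (rule projection_along_eq_0[OF V(4) assms(5)])
  finally show ?thesis
    using assms(4) by (simp add: nth_deriv_const[OF V(1,2)])
qed

lemma symplectic_form_bounded_bilinear: "symplectic_form \<omega> \<Longrightarrow> bounded_bilinear \<omega>"
  by (simp add: symplectic_form_def bilinear_conv_bounded_bilinear)

lemma symplectic_form_skew:
  assumes "symplectic_form \<omega>"
  shows "\<omega> v u = - \<omega> u v"
proof -
  interpret \<omega>: bounded_bilinear \<omega>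
    using assms by (rule symplectic_form_bounded_bilinear)
  have "\<omega> (u + v) (u + v) = 0" "\<omega> u u = 0" "\<omega> v v = 0"
    using assms by (auto simp: symplectic_form_def)
  then show ?thesis by (simp add: \<omega>.add_left \<omega>.add_right)
qed

lemma velocity_form_eq:
  assumes "symplectic_form \<omega>" and "open U" "\<tau> \<in> U"
    and v: "smooth_on U v" "\<And>t. t \<in> U \<Longrightarrow> v t \<in> \<Gamma> t"
    and isotropic: "\<And>t x y. t \<in> U \<Longrightarrow> x \<in> \<Gamma> t \<Longrightarrow> y \<in> \<Gamma> t \<Longrightarrow> \<omega> x y = 0"
  shows "velocity_form \<omega> \<Gamma> \<tau> (v \<tau>) = \<omega> (v \<tau>) (vector_derivative v (at \<tau>))"
  unfolding velocity_form_def
proof (rule the_equality)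
  show "\<exists>w V. open V \<and> \<tau> \<in> V \<and> smooth_on V w \<and> (\<forall>t\<in>V. w t \<in> \<Gamma> t) \<and> w \<tau> = v \<tau> \<and>
      \<omega> (v \<tau>) (vector_derivative v (at \<tau>)) = \<omega> (v \<tau>) (vector_derivative w (at \<tau>))"
    using assms(2,3) v by blast
next
  interpret \<omega>: bounded_bilinear \<omega>
    using assms(1) by (rule symplectic_form_bounded_bilinear)
  fix c
  assume "\<exists>w V. open V \<and> \<tau> \<in> V \<and> smooth_on V w \<and> (\<forall>t\<in>V. w t \<in> \<Gamma> t) \<and> w \<tau> = v \<tau> \<and>
      c = \<omega> (v \<tau>) (vector_derivative w (at \<tau>))"
  then obtain w V where V: "open V" "\<tau> \<in> V" and w: "smooth_on V w" "\<forall>t\<in>V. w t \<in> \<Gamma> t" "w \<tau> = v \<tau>"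
    and c: "c = \<omega> (v \<tau>) (vector_derivative w (at \<tau>))"
    by blast
  let ?v' = "vector_derivative v (at \<tau>)" and ?w' = "vector_derivative w (at \<tau>)"
  have "((\<lambda>t. \<omega> (w t) (v t)) has_vector_derivative 0) (at \<tau>)"
  proof (rule has_vector_derivative_transform_within_open[OF has_vector_derivative_const])
    show "open (U \<inter> V)" "\<tau> \<in> U \<inter> V" using assms(2,3) V by auto
    show "0 = \<omega> (w t) (v t)" if "t \<in> U \<inter> V" for t
      using that w(2) v(2) isotropic[of t "w t" "v t"] by auto
  qed
  moreover have "((\<lambda>t. \<omega> (w t) (v t)) has_vector_derivative \<omega> (w \<tau>) ?v' + \<omega> ?w' (v \<tau>)) (at \<tau>)"
    using smooth_on_has_vector_derivative[OF w(1) V(2)]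
      smooth_on_has_vector_derivative[OF v(1) assms(3)]
    by (rule \<omega>.has_vector_derivative)
  ultimately have "\<omega> (w \<tau>) ?v' + \<omega> ?w' (v \<tau>) = 0"
    by (rule vector_derivative_unique_at[symmetric])
  then show "c = \<omega> (v \<tau>) ?v'"
    using symplectic_form_skew[OF assms(1), of ?w' "v \<tau>"] w(3) c by simp
qed

section \<open>Pencils of Lagrangian subspaces\<close>

definition pencil_plane ::
    "'b::real_vector set \<Rightarrow> ('b \<Rightarrow> 'a::real_vector) \<Rightarrow> ('b \<Rightarrow> 'a) \<Rightarrow> real \<Rightarrow> real \<Rightarrow> 'a set" where
  "pencil_plane S e f a b = (\<lambda>u. a *\<^sub>R e u + b *\<^sub>R f u) ` S"

definition pencil ::
    "'b::real_vector set \<Rightarrow> ('b \<Rightarrow> 'a::real_vector) \<Rightarrow> ('b \<Rightarrow> 'a) \<Rightarrow> 'a set set" where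
  "pencil S e f = {pencil_plane S e f a b | a b. a \<noteq> 0 \<or> b \<noteq> 0}"

lemma pencil_plane_change_frame:
  "pencil_plane S (\<lambda>u. a *\<^sub>R e u + b *\<^sub>R f u) (\<lambda>u. c *\<^sub>R e u + d *\<^sub>R f u) x y =
    pencil_plane S e f (x * a + y * c) (x * b + y * d)"
  unfolding pencil_plane_def by (simp add: algebra_simps)

lemma pencil_change_frame:
  assumes "a * d \<noteq> b * c"
  shows "pencil S (\<lambda>u. a *\<^sub>R e u + b *\<^sub>R f u) (\<lambda>u. c *\<^sub>R e u + d *\<^sub>R f u) = pencil S e f"
    (is "pencil S ?e ?f = _")
proof (intro equalityI subsetI)
  fix \<Lambda> assume "\<Lambda> \<in> pencil S ?e ?f"
  then obtain x y where xy: "x \<noteq> 0 \<or> y \<noteq> 0" "\<Lambda> = pencil_plane S e f (x * a + y * c) (x * b + y * d)"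
    unfolding pencil_def pencil_plane_change_frame by blast
  have "x * (a * d - b * c) = d * (x * a + y * c) - c * (x * b + y * d)"
    "y * (a * d - b * c) = a * (x * b + y * d) - b * (x * a + y * c)"
    by (simp_all add: algebra_simps)
  then have "x * a + y * c \<noteq> 0 \<or> x * b + y * d \<noteq> 0"
    using xy(1) assms by auto
  then show "\<Lambda> \<in> pencil S e f" unfolding pencil_def xy(2) by blast
next
  fix \<Lambda> assume "\<Lambda> \<in> pencil S e f"
  then obtain p q where pq: "p \<noteq> 0 \<or> q \<noteq> 0" "\<Lambda> = pencil_plane S e f p q"
    unfolding pencil_def by blast
  define D where "D = a * d - b * c"
  define x y where "x = (p * d - q * c) / D" and "y = (q * a - p * b) / D"
  have "D \<noteq> 0" using assms by (simp add: D_def)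
  then have Cramer: "D * x = p * d - q * c" "D * y = q * a - p * b"
    by (simp_all add: x_def y_def)
  have "D * (x * a + y * c) = D * x * a + D * y * c" "D * (x * b + y * d) = D * x * b + D * y * d"
    by (simp_all add: algebra_simps)
  then have "D * (x * a + y * c) = D * p" "D * (x * b + y * d) = D * q"
    unfolding Cramer by (simp_all add: D_def algebra_simps)
  then have "x * a + y * c = p" "x * b + y * d = q"
    using \<open>D \<noteq> 0\<close> by simp_all
  then have "x \<noteq> 0 \<or> y \<noteq> 0" "\<Lambda> = pencil_plane S ?e ?f x y"
    using pq unfolding pencil_plane_change_frame by auto
  then show "\<Lambda> \<in> pencil S ?e ?f" unfolding pencil_def by blast
qed

locale lagrangian_pencil =
  fixes \<omega> :: "'a::euclidean_space \<Rightarrow> 'a \<Rightarrow> real"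
    and S :: "'b::euclidean_space set" and e f :: "'b \<Rightarrow> 'a"
  assumes symplectic: "symplectic_form \<omega>"
    and subspace: "subspace S" and dim: "2 * dim S = DIM('a)"
    and linear_e: "linear e" and linear_f: "linear f"
    and independent: "\<And>u v. u \<in> S \<Longrightarrow> v \<in> S \<Longrightarrow> e u + f v = 0 \<Longrightarrow> u = 0 \<and> v = 0"
    and isotropic_e: "\<And>u v. u \<in> S \<Longrightarrow> v \<in> S \<Longrightarrow> \<omega> (e u) (e v) = 0"
    and isotropic_f: "\<And>u v. u \<in> S \<Longrightarrow> v \<in> S \<Longrightarrow> \<omega> (f u) (f v) = 0"
    and symmetric: "\<And>u v. u \<in> S \<Longrightarrow> v \<in> S \<Longrightarrow> \<omega> (e u) (f v) = \<omega> (e v) (f u)"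
begin

abbreviation plane :: "real \<Rightarrow> real \<Rightarrow> 'a set" where
  "plane \<equiv> pencil_plane S e f"

sublocale \<omega>: bounded_bilinear \<omega>
  using symplectic by (rule symplectic_form_bounded_bilinear)

lemmas linear_simps = linear_add[OF linear_e] linear_add[OF linear_f]
  linear_diff[OF linear_e] linear_diff[OF linear_f]
  linear_scale[OF linear_e] linear_scale[OF linear_f]
  linear_0[OF linear_e] linear_0[OF linear_f]
lemmas bilinear_simps = \<omega>.add_left \<omega>.add_right \<omega>.scaleR_left \<omega>.scaleR_right

lemma \<omega>_f_e: "u \<in> S \<Longrightarrow> v \<in> S \<Longrightarrow> \<omega> (f u) (e v) = - \<omega> (e u) (f v)"
  using symplectic_form_skew[OF symplectic, of "f u" "e v"] symmetric[of u v] by simp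

lemma components_unique:
  assumes "u \<in> S" "v \<in> S" "u' \<in> S" "v' \<in> S" "e u + f v = e u' + f v'"
  shows "u = u'" "v = v'"
proof -
  have "e (u - u') + f (v - v') = 0"
    using assms(5) by (simp add: linear_simps algebra_simps)
  then show "u = u'" "v = v'"
    using independent[of "u - u'" "v - v'"] assms(1-4) by (simp_all add: subspace_diff[OF subspace])
qed

lemma change_frame:
  assumes "a * d \<noteq> b * c"
  shows "lagrangian_pencil \<omega> S (\<lambda>u. a *\<^sub>R e u + b *\<^sub>R f u) (\<lambda>u. c *\<^sub>R e u + d *\<^sub>R f u)"
proof (rule lagrangian_pencil.intro)
  show "linear (\<lambda>u. a *\<^sub>R e u + b *\<^sub>R f u)" "linear (\<lambda>u. c *\<^sub>R e u + d *\<^sub>R f u)"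
    by (intro linear_compose_add linear_compose_scale_right linear_e linear_f)+
  fix u v assume uv: "u \<in> S" "v \<in> S"
  note S = subspace_add[OF subspace] subspace_scale[OF subspace]
  show "\<omega> (a *\<^sub>R e u + b *\<^sub>R f u) (a *\<^sub>R e v + b *\<^sub>R f v) = 0"
    "\<omega> (c *\<^sub>R e u + d *\<^sub>R f u) (c *\<^sub>R e v + d *\<^sub>R f v) = 0"
    "\<omega> (a *\<^sub>R e u + b *\<^sub>R f u) (c *\<^sub>R e v + d *\<^sub>R f v) =
      \<omega> (a *\<^sub>R e v + b *\<^sub>R f v) (c *\<^sub>R e u + d *\<^sub>R f u)"
    using uv symmetric[OF uv]
    by (simp_all add: bilinear_simps isotropic_e isotropic_f \<omega>_f_e)
  assume "a *\<^sub>R e u + b *\<^sub>R f u + (c *\<^sub>R e v + d *\<^sub>R f v) = 0"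
  then have "e (a *\<^sub>R u + c *\<^sub>R v) + f (b *\<^sub>R u + d *\<^sub>R v) = 0"
    by (simp add: linear_simps algebra_simps)
  then have zero: "a *\<^sub>R u + c *\<^sub>R v = 0" "b *\<^sub>R u + d *\<^sub>R v = 0"
    using independent[of "a *\<^sub>R u + c *\<^sub>R v" "b *\<^sub>R u + d *\<^sub>R v"] uv by (simp_all add: S)
  have "(a * d - b * c) *\<^sub>R u = d *\<^sub>R (a *\<^sub>R u + c *\<^sub>R v) - c *\<^sub>R (b *\<^sub>R u + d *\<^sub>R v)"
    "(a * d - b * c) *\<^sub>R v = a *\<^sub>R (b *\<^sub>R u + d *\<^sub>R v) - b *\<^sub>R (a *\<^sub>R u + c *\<^sub>R v)"
    by (simp_all add: algebra_simps)
  then have "(a * d - b * c) *\<^sub>R u = 0" "(a * d - b * c) *\<^sub>R v = 0"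
    unfolding zero by simp_all
  then show "u = 0 \<and> v = 0" using assms by simp
qed (use symplectic subspace dim in auto)

lemma plane_1_0_lagrangian: "plane 1 0 \<in> lagrangian_grassmannian \<omega>"
proof -
  have "u = 0" if "u \<in> S" "e u = 0" for u
    using independent[OF that(1) subspace_0[OF subspace]] that(2) linear_0[OF linear_f] by simp
  then have "inj_on e (span S)"
    unfolding span_eq_iff[THEN iffD2, OF subspace]
    using linear_inj_on_iff_eq_0[OF linear_e subspace] by blast
  then have "dim (e ` S) = dim S"
    by (rule dim_image_eq[OF linear_e])
  then show ?thesis
    using linear_subspace_image[OF linear_e subspace] isotropic_e dim
    by (auto simp: lagrangian_grassmannian_def pencil_plane_def)
qed

lemma plane_1_0_Int_plane_0_1: "plane 1 0 \<inter> plane 0 1 = {0}"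
proof
  show "plane 1 0 \<inter> plane 0 1 \<subseteq> {0}"
  proof
    fix w assume "w \<in> plane 1 0 \<inter> plane 0 1"
    then obtain u v where uv: "u \<in> S" "v \<in> S" "w = e u" "w = f v"
      unfolding pencil_plane_def by auto
    then have "e u + f (- v) = 0" by (simp add: linear_neg[OF linear_f])
    then have "u = 0" using independent[OF uv(1) subspace_neg[OF subspace uv(2)]] by blast
    then show "w \<in> {0}" using uv(3) linear_0[OF linear_e] by simp
  qed
  show "{0} \<subseteq> plane 1 0 \<inter> plane 0 1"
    using subspace_0[OF subspace] linear_0[OF linear_e] linear_0[OF linear_f]
    unfolding pencil_plane_def by force
qed

lemma plane_transversal:
  assumes "a * d \<noteq> b * c"
  shows "plane a b \<in> transversals \<omega> (plane c d)"
proof -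
  interpret frame: lagrangian_pencil \<omega> S "\<lambda>u. a *\<^sub>R e u + b *\<^sub>R f u" "\<lambda>u. c *\<^sub>R e u + d *\<^sub>R f u"
    using assms by (rule change_frame)
  show ?thesis
    using frame.plane_1_0_lagrangian frame.plane_1_0_Int_plane_0_1
    by (simp add: transversals_def pencil_plane_change_frame)
qed

lemma plane_lagrangian:
  assumes "a \<noteq> 0 \<or> b \<noteq> 0"
  shows "plane a b \<in> lagrangian_grassmannian \<omega>"
proof -
  have "a * a \<noteq> b * - b" using assms by (auto simp: eq_neg_iff_add_eq_0)
  then show ?thesis using plane_transversal[of a a b "- b"] by (simp add: transversals_def)
qed

lemma plane_complementary:
  assumes "a * d \<noteq> b * c"
  shows "complementary (plane a b) (plane c d)"
proof -
  have "plane c d \<in> lagrangian_grassmannian \<omega>" using assms by (intro plane_lagrangian) auto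
  then show ?thesis
    using plane_transversal[OF assms] by (simp add: transversals_iff_complementary)
qed

lemma plane_neq:
  assumes "a * d \<noteq> b * c"
  shows "plane a b \<noteq> plane c d"
proof
  assume "plane a b = plane c d"
  then have "plane a b = {0}" using complementaryD(3)[OF plane_complementary[OF assms]] by simp
  moreover have "plane a b \<in> lagrangian_grassmannian \<omega>"
    using plane_transversal[OF assms] by (simp add: transversals_def)
  ultimately show False using dim_lagrangian_pos by fastforce
qed

lemma plane_scale:
  assumes "r \<noteq> 0"
  shows "plane (r * a) (r * b) = plane a b"
proof -
  have "(\<lambda>u. r *\<^sub>R u) ` S = S"
  proof (intro equalityI subsetI)
    fix u assume "u \<in> S"
    then have "inverse r *\<^sub>R u \<in> S" "u = r *\<^sub>R (inverse r *\<^sub>R u)"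
      using assms by (simp_all add: subspace_scale[OF subspace])
    then show "u \<in> (\<lambda>u. r *\<^sub>R u) ` S" by blast
  qed (use subspace_scale[OF subspace] in auto)
  then have "plane a b = (\<lambda>u. a *\<^sub>R e u + b *\<^sub>R f u) ` (\<lambda>u. r *\<^sub>R u) ` S"
    by (simp add: pencil_plane_def)
  then show ?thesis
    by (simp add: pencil_plane_def image_image linear_simps mult.commute)
qed

lemma pencil_eq_insert: "pencil S e f = insert (plane 0 1) (range (plane 1))"
proof (intro equalityI subsetI)
  fix \<Lambda> assume "\<Lambda> \<in> pencil S e f"
  then obtain a b where ab: "a \<noteq> 0 \<or> b \<noteq> 0" "\<Lambda> = plane a b"
    unfolding pencil_def by blast
  show "\<Lambda> \<in> insert (plane 0 1) (range (plane 1))"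
  proof (cases "a = 0")
    case True
    then show ?thesis using ab plane_scale[of b 0 1] by simp
  next
    case False
    then show ?thesis using ab plane_scale[of a 1 "b / a"] by simp
  qed
next
  have "plane a b \<in> pencil S e f" if "a \<noteq> 0 \<or> b \<noteq> 0" for a b
    using that unfolding pencil_def by blast
  from this[of 0 1] this[of 1]
  show "\<Lambda> \<in> pencil S e f" if "\<Lambda> \<in> insert (plane 0 1) (range (plane 1))" for \<Lambda>
    using that by auto
qed

lemma pencil_minus_plane_0_1: "pencil S e f - {plane 0 1} = range (plane 1)"
proof -
  have "plane 0 1 \<noteq> plane 1 x" for x by (rule plane_neq) simp
  then show ?thesis by (auto simp: pencil_eq_insert)
qed

lemma inj_plane_1: "inj (plane 1)"
proof (rule injI)
  fix x y assume "plane 1 x = plane 1 y"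
  then show "x = y" using plane_neq[of 1 y x 1] by auto
qed

lemma nonzero_exists:
  obtains u where "u \<in> S" "u \<noteq> 0"
proof -
  have "dim S \<noteq> 0" using dim DIM_positive[where 'a='a] by linarith
  then have "\<not> S \<subseteq> {0}" by simp
  then show ?thesis using that by blast
qed

lemma decomposition:
  obtains u v where "u \<in> S" "v \<in> S" "w = e u + f v"
proof -
  have compl: "complementary (plane 1 0) (plane 0 1)" by (rule plane_complementary) simp
  obtain u where u: "u \<in> S" "projection_along (plane 1 0) (plane 0 1) w = e u"
    using projection_along_in[OF compl, of w] by (auto simp: pencil_plane_def)
  have "w - e u \<in> plane 0 1"
    using diff_projection_along_in[OF compl, of w] unfolding u(2) .
  then obtain v where v: "v \<in> S" "w - e u = f v"
    by (auto simp: pencil_plane_def)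
  show ?thesis using that[OF u(1) v(1)] v(2) by (simp add: algebra_simps)
qed

lemma \<omega>_e_f_nondegenerate:
  assumes "u \<in> S" "\<And>v. v \<in> S \<Longrightarrow> \<omega> (e u) (f v) = 0"
  shows "u = 0"
proof -
  have "\<omega> (e u) w = 0" for w
  proof -
    obtain u' v where "u' \<in> S" "v \<in> S" "w = e u' + f v" by (rule decomposition)
    then show ?thesis using assms by (simp add: \<omega>.add_right isotropic_e)
  qed
  then have "e u = 0" using symplectic by (simp add: symplectic_form_def)
  then show ?thesis
    using independent[OF assms(1) subspace_0[OF subspace]] linear_0[OF linear_f] by simp
qed

lemma projection_along_plane_0_1:
  assumes "u \<in> S" "v \<in> S"
  shows "projection_along (plane 1 x) (plane 0 1) (e u + f v) = e u + x *\<^sub>R f u"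
proof (rule projection_along_eqI)
  show "complementary (plane 1 x) (plane 0 1)" by (rule plane_complementary) simp
  show "e u + x *\<^sub>R f u \<in> plane 1 x" using assms(1) by (auto simp: pencil_plane_def)
  have "v - x *\<^sub>R u \<in> S" using assms subspace by (simp add: subspace_diff subspace_scale)
  moreover have "e u + f v - (e u + x *\<^sub>R f u) = f (v - x *\<^sub>R u)" by (simp add: linear_simps)
  ultimately show "e u + f v - (e u + x *\<^sub>R f u) \<in> plane 0 1" by (auto simp: pencil_plane_def)
qed

lemma projection_along_plane_0_1_affine:
  "projection_along (plane 1 x) (plane 0 1) = projection_along (plane 1 0) (plane 0 1) +
    x *\<^sub>R (projection_along (plane 1 1) (plane 0 1) - projection_along (plane 1 0) (plane 0 1))"
proof (rule blinfun_eqI)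
  fix w
  obtain u v where "u \<in> S" "v \<in> S" "w = e u + f v" by (rule decomposition)
  then show "projection_along (plane 1 x) (plane 0 1) w = (projection_along (plane 1 0) (plane 0 1) +
    x *\<^sub>R (projection_along (plane 1 1) (plane 0 1) - projection_along (plane 1 0) (plane 0 1))) w"
    by (simp add: projection_along_plane_0_1 blinfun.add_left blinfun.diff_left blinfun.scaleR_left)
qed

lemma smooth_lagrangian_curve_plane:
  assumes "open J" "smooth_on J h" "\<And>t. t \<in> J \<Longrightarrow> \<Gamma> t = plane 1 (h t)"
  shows "smooth_lagrangian_curve \<omega> J \<Gamma>"
proof (rule smooth_lagrangian_curveI[OF assms(1)])
  show "plane 0 1 \<in> lagrangian_grassmannian \<omega>" by (rule plane_lagrangian) simp
  show "\<Gamma> t \<in> transversals \<omega> (plane 0 1)" if "t \<in> J" for t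
    unfolding assms(3)[OF that] by (rule plane_transversal) simp
  show "smooth_on J (\<lambda>t. projection_along (\<Gamma> t) (plane 0 1))"
  proof (rule smooth_on_cong[OF assms(1)])
    let ?P = "\<lambda>x. projection_along (plane 1 x) (plane 0 1)"
    show "smooth_on J (\<lambda>t. ?P 0 + h t *\<^sub>R (?P 1 - ?P 0))"
      by (intro smooth_on_add smooth_on_const bounded_linear.smooth_on[OF bounded_linear_scaleR_left]
          assms(1,2))
    show "projection_along (\<Gamma> t) (plane 0 1) = ?P 0 + h t *\<^sub>R (?P 1 - ?P 0)" if "t \<in> J" for t
      unfolding assms(3)[OF that] by (rule projection_along_plane_0_1_affine)
  qed
qed

lemma smooth_on_coordinate:
  assumes "smooth_lagrangian_curve \<omega> I \<Gamma>" and \<Gamma>: "\<And>t. t \<in> I \<Longrightarrow> \<Gamma> t = plane 1 (g t)"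
  shows "smooth_on I g"
proof (rule smooth_on_local)
  fix \<tau> assume \<tau>: "\<tau> \<in> I"
  have compl: "complementary (\<Gamma> \<tau>) (plane 0 1)"
    unfolding \<Gamma>[OF \<tau>] by (rule plane_complementary) simp
  obtain V where V: "open V" "\<tau> \<in> V" "V \<subseteq> I"
    and smooth: "smooth_on V (\<lambda>t. projection_along (\<Gamma> t) (plane 0 1))"
    by (rule smooth_lagrangian_curve_projection_along[OF assms(1) \<tau> compl])
  obtain u where u: "u \<in> S" "u \<noteq> 0" by (rule nonzero_exists)
  define w where "w = f u /\<^sub>R (f u \<bullet> f u)"
  have "f u \<noteq> 0"
    using independent[OF subspace_0[OF subspace] u(1)] u(2) by (auto simp: linear_simps)
  then have w: "f u \<bullet> w = 1" by (simp add: w_def)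
  have "smooth_on V g"
  proof (rule smooth_on_cong[OF V(1)])
    show "smooth_on V (\<lambda>t. (projection_along (\<Gamma> t) (plane 0 1) (e u) + - e u) \<bullet> w)"
      by (intro bounded_linear.smooth_on[OF bounded_linear_inner_left] smooth_on_add smooth_on_const
          bounded_linear.smooth_on[OF blinfun.bounded_linear_left] V(1) smooth)
    fix t assume "t \<in> V"
    then have "\<Gamma> t = plane 1 (g t)" using V(3) by (intro \<Gamma>) blast
    then have "projection_along (\<Gamma> t) (plane 0 1) (e u) = e u + g t *\<^sub>R f u"
      using projection_along_plane_0_1[OF u(1) subspace_0[OF subspace], of "g t"]
      by (simp add: linear_simps)
    then show "g t = (projection_along (\<Gamma> t) (plane 0 1) (e u) + - e u) \<bullet> w"
      by (simp add: w)
  qed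
  then show "\<exists>V. \<tau> \<in> V \<and> smooth_on V g" using V(2) by blast
qed

end

lemma graph_over_inject:
  assumes "complementary \<Gamma>\<^sub>0 \<Delta>" and A: "A \<in> lin_maps \<Delta>" and B: "B \<in> lin_maps \<Delta>"
    and graph: "graph_over \<Gamma>\<^sub>0 A = graph_over \<Gamma>\<^sub>0 B"
  shows "A = B"
proof (rule blinfun_eqI)
  fix w
  let ?u = "projection_along \<Gamma>\<^sub>0 \<Delta> w"
  have u: "?u \<in> \<Gamma>\<^sub>0" by (rule projection_along_in[OF assms(1)])
  then have "?u + A ?u \<in> graph_over \<Gamma>\<^sub>0 B"
    unfolding graph[symmetric] by (simp add: graph_over_def)
  then obtain v where v: "v \<in> \<Gamma>\<^sub>0" "?u + A ?u = v + B v"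
    unfolding graph_over_def by blast
  have "?u + A ?u - ?u \<in> \<Delta>" using lin_mapsD(1)[OF A] by simp
  moreover have "?u + A ?u - v \<in> \<Delta>" unfolding v(2) using lin_mapsD(1)[OF B] by simp
  ultimately have "?u = v"
    by (rule complementary_component_unique[OF assms(1) u v(1)])
  then have "A ?u = B ?u" using v(2) by simp
  moreover have "A (w - ?u) = 0" "B (w - ?u) = 0"
    using diff_projection_along_in[OF assms(1)] lin_mapsD(2)[OF A] lin_mapsD(2)[OF B] by blast+
  ultimately show "A w = B w" by (simp add: blinfun.diff_right)
qed

lemma regular_line_direction_injective:
  assumes compl: "complementary \<Gamma>\<^sub>0 \<Delta>" and A: "A \<in> lin_maps \<Delta>" and B: "B \<in> lin_maps \<Delta>" "B \<noteq> 0"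
    and regular: "regular_line (range (\<lambda>s::real. graph_over \<Gamma>\<^sub>0 (A + s *\<^sub>R B)))"
    and v: "v \<in> \<Gamma>\<^sub>0" "B v = 0"
  shows "v = 0"
proof -
  let ?\<Gamma> = "\<lambda>s::real. graph_over \<Gamma>\<^sub>0 (A + s *\<^sub>R B)"
  have "A + B \<in> lin_maps \<Delta>"
    using A B(1) subspace_add[OF complementaryD(2)[OF compl]]
    by (simp add: lin_maps_def blinfun.add_left)
  then have "?\<Gamma> 0 \<noteq> ?\<Gamma> 1"
    using graph_over_inject[OF compl A, of "A + B"] B(2) by auto
  then have "?\<Gamma> 0 \<inter> ?\<Gamma> 1 = {0}"
    using regular unfolding regular_line_def by blast
  moreover have "v + A v \<in> ?\<Gamma> s" for s
    using v by (auto simp: graph_over_def blinfun.bilinear_simps intro: image_eqI[of _ _ v])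
  ultimately have "v + A v = 0" by blast
  then show ?thesis by (rule complementary_add_eq_0[OF compl v(1) lin_mapsD(1)[OF A]])
qed

lemma lagrangian_pencil_graphs:
  fixes \<omega> :: "'a::euclidean_space \<Rightarrow> 'a \<Rightarrow> real"
  assumes "symplectic_form \<omega>" and \<Delta>: "\<Delta> \<in> lagrangian_grassmannian \<omega>" and \<Gamma>\<^sub>0: "\<Gamma>\<^sub>0 \<in> transversals \<omega> \<Delta>"
    and A: "A \<in> symmetric_maps \<omega> \<Gamma>\<^sub>0 \<Delta>" and B: "B \<in> symmetric_maps \<omega> \<Gamma>\<^sub>0 \<Delta>"
    and injective: "\<And>v. v \<in> \<Gamma>\<^sub>0 \<Longrightarrow> B v = 0 \<Longrightarrow> v = 0"
  shows "lagrangian_pencil \<omega> \<Gamma>\<^sub>0 (\<lambda>u. u + A u) B"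
proof (rule lagrangian_pencil.intro)
  interpret \<omega>: bounded_bilinear \<omega>
    using assms(1) by (rule symplectic_form_bounded_bilinear)
  have compl: "complementary \<Gamma>\<^sub>0 \<Delta>" and \<Gamma>\<^sub>0': "\<Gamma>\<^sub>0 \<in> lagrangian_grassmannian \<omega>"
    using \<Gamma>\<^sub>0 transversals_iff_complementary[OF \<Delta>] by auto
  have in_\<Delta>: "A u \<in> \<Delta>" "B u \<in> \<Delta>" for u
    using A B lin_mapsD(1) by (auto simp: symmetric_maps_def)
  have sym: "\<omega> (A u) v = - \<omega> u (A v)" "\<omega> (B u) v = - \<omega> u (B v)" if "u \<in> \<Gamma>\<^sub>0" "v \<in> \<Gamma>\<^sub>0" for u v
    using A B that by (auto simp: symmetric_maps_def add_eq_0_iff)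
  note zero = lagrangianD(2)[OF \<Delta>] lagrangianD(2)[OF \<Gamma>\<^sub>0']
  show "subspace \<Gamma>\<^sub>0" "2 * dim \<Gamma>\<^sub>0 = DIM('a)"
    using lagrangianD(1,3)[OF \<Gamma>\<^sub>0'] by auto
  show "linear (\<lambda>u. u + A u)" "linear B"
    by (intro linear_compose_add linear_ident bounded_linear.linear blinfun.bounded_linear_right)+
  fix u v assume uv: "u \<in> \<Gamma>\<^sub>0" "v \<in> \<Gamma>\<^sub>0"
  show "\<omega> (u + A u) (v + A v) = 0" "\<omega> (B u) (B v) = 0"
    using uv by (simp_all add: \<omega>.add_left \<omega>.add_right zero in_\<Delta> sym)
  show "\<omega> (u + A u) (B v) = \<omega> (v + A v) (B u)"
    using uv symplectic_form_skew[OF assms(1), of "B u" v]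
    by (simp add: \<omega>.add_left zero in_\<Delta> sym)
  assume sum: "u + A u + B v = 0"
  have "A u + B v \<in> \<Delta>"
    using in_\<Delta> by (intro subspace_add complementaryD(2)[OF compl])
  then have "u = 0"
    using sum by (intro complementary_add_eq_0[OF compl uv(1)]) (simp_all add: add.assoc)
  then show "u = 0 \<and> v = 0" using sum injective[OF uv(2)] by simp
qed (rule assms(1))

lemma regular_cycle_eq_pencil:
  fixes \<omega> :: "'a::euclidean_space \<Rightarrow> 'a \<Rightarrow> real"
  assumes "symplectic_form \<omega>" "regular_cycle \<omega> C"
  obtains S :: "'a set" and e f where "lagrangian_pencil \<omega> S e f" "C = pencil S e f"
proof -
  obtain \<Delta> \<Gamma>\<^sub>0 A B where \<Delta>: "\<Delta> \<in> lagrangian_grassmannian \<omega>" and \<Gamma>\<^sub>0: "\<Gamma>\<^sub>0 \<in> transversals \<omega> \<Delta>"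
    and A: "A \<in> symmetric_maps \<omega> \<Gamma>\<^sub>0 \<Delta>" and B: "B \<in> symmetric_maps \<omega> \<Gamma>\<^sub>0 \<Delta>" "B \<noteq> 0"
    and regular: "regular_line (range (\<lambda>s::real. graph_over \<Gamma>\<^sub>0 (A + s *\<^sub>R B)))"
    and C: "C = insert \<Delta> (range (\<lambda>s::real. graph_over \<Gamma>\<^sub>0 (A + s *\<^sub>R B)))"
    using assms(2) unfolding regular_cycle_def affine_line_def by blast
  have compl: "complementary \<Gamma>\<^sub>0 \<Delta>"
    using \<Gamma>\<^sub>0 transversals_iff_complementary[OF \<Delta>] by blast
  have lin: "A \<in> lin_maps \<Delta>" "B \<in> lin_maps \<Delta>"
    using A B by (auto simp: symmetric_maps_def)
  interpret lagrangian_pencil \<omega> \<Gamma>\<^sub>0 "\<lambda>u. u + A u" B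
    using lagrangian_pencil_graphs[OF assms(1) \<Delta> \<Gamma>\<^sub>0 A B(1)]
      regular_line_direction_injective[OF compl lin B(2) regular] by blast
  have "plane 0 1 = \<Delta>"
  proof (rule subspace_dim_equal)
    have "plane 0 1 \<in> lagrangian_grassmannian \<omega>" by (rule plane_lagrangian) simp
    from lagrangianD(1,3)[OF this] show "subspace (plane 0 1)" "dim \<Delta> \<le> dim (plane 0 1)"
      using lagrangianD(3)[OF \<Delta>] by auto
    show "plane 0 1 \<subseteq> \<Delta>"
      using lin_mapsD(1)[OF lin(2)] by (auto simp: pencil_plane_def)
  qed (rule lagrangianD(1)[OF \<Delta>])
  moreover have "plane 1 = (\<lambda>s. graph_over \<Gamma>\<^sub>0 (A + s *\<^sub>R B))"
    by (simp add: fun_eq_iff pencil_plane_def graph_over_def blinfun.bilinear_simps add.assoc)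
  ultimately have "C = pencil \<Gamma>\<^sub>0 (\<lambda>u. u + A u) B"
    unfolding C pencil_eq_insert by simp
  with lagrangian_pencil_axioms show ?thesis by (rule that)
qed

lemma regular_cycle_minus:
  fixes \<omega> :: "'a::euclidean_space \<Rightarrow> 'a \<Rightarrow> real"
  assumes "symplectic_form \<omega>" "regular_cycle \<omega> C" "\<Lambda> \<in> C"
  obtains S :: "'a set" and e f
  where "lagrangian_pencil \<omega> S e f" "C - {\<Lambda>} = range (pencil_plane S e f 1)"
proof -
  obtain S :: "'a set" and e f where pencil: "lagrangian_pencil \<omega> S e f" and C: "C = pencil S e f"
    using assms(1,2) by (rule regular_cycle_eq_pencil)
  then obtain a b where ab: "a \<noteq> 0 \<or> b \<noteq> 0" "\<Lambda> = pencil_plane S e f a b"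
    using assms(3) unfolding pencil_def by blast
  let ?e = "\<lambda>u. b *\<^sub>R e u + (- a) *\<^sub>R f u" and ?f = "\<lambda>u. a *\<^sub>R e u + b *\<^sub>R f u"
  have frame: "b * b \<noteq> - a * a"
    using ab(1) by (auto simp: eq_neg_iff_add_eq_0)
  interpret lagrangian_pencil \<omega> S ?e ?f
    using pencil frame by (rule lagrangian_pencil.change_frame)
  have "C - {\<Lambda>} = pencil S ?e ?f - {plane 0 1}"
    unfolding C ab(2) pencil_change_frame[OF frame] pencil_plane_change_frame by simp
  then have "C - {\<Lambda>} = range (plane 1)"
    unfolding pencil_minus_plane_0_1 .
  with lagrangian_pencil_axioms show ?thesis by (rule that)
qed

section \<open>Curves in a pencil\<close>

locale pencil_curve = lagrangian_pencil \<omega> S e f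
  for \<omega> :: "'a::euclidean_space \<Rightarrow> 'a \<Rightarrow> real" and S :: "'b::euclidean_space set" and e f :: "'b \<Rightarrow> 'a" +
  fixes J :: "real set" and h :: "real \<Rightarrow> real" and \<Gamma> :: "real \<Rightarrow> 'a set"
  assumes open_J: "open J" and smooth_h: "smooth_on J h"
    and \<Gamma>_eq_plane: "\<And>t. t \<in> J \<Longrightarrow> \<Gamma> t = plane 1 (h t)"
begin

definition moving_frame :: "real \<Rightarrow> 'b \<Rightarrow> 'a" where
  "moving_frame t u = e u + h t *\<^sub>R f u"

lemma \<Gamma>_eq_image: "t \<in> J \<Longrightarrow> \<Gamma> t = moving_frame t ` S"
  by (simp add: \<Gamma>_eq_plane pencil_plane_def moving_frame_def)

lemma moving_frame_add: "moving_frame t (u + v) = moving_frame t u + moving_frame t v"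
  by (simp add: moving_frame_def linear_simps algebra_simps)

lemma moving_frame_eq_f:
  assumes "u \<in> S" "v \<in> S" "moving_frame t u = f v"
  shows "u = 0" "v = 0"
proof -
  have "e u + f (h t *\<^sub>R u) = e 0 + f v"
    using assms(3) by (simp add: moving_frame_def linear_simps)
  from components_unique[OF assms(1) subspace_scale[OF subspace assms(1)] subspace_0[OF subspace]
      assms(2) this]
  show "u = 0" "v = 0" by simp_all
qed

lemma smooth_curve: "smooth_lagrangian_curve \<omega> J \<Gamma>"
  using open_J smooth_h \<Gamma>_eq_plane by (rule smooth_lagrangian_curve_plane)

lemma \<Gamma>_lagrangian: "t \<in> J \<Longrightarrow> \<Gamma> t \<in> lagrangian_grassmannian \<omega>"
  using smooth_curve by (simp add: smooth_lagrangian_curve_def)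

lemma velocity_form_moving_frame:
  assumes "\<tau> \<in> J" "u \<in> S"
  shows "velocity_form \<omega> \<Gamma> \<tau> (moving_frame \<tau> u) = vector_derivative h (at \<tau>) * \<omega> (e u) (f u)"
proof -
  have "((\<lambda>t. moving_frame t u) has_vector_derivative 0 + vector_derivative h (at \<tau>) *\<^sub>R f u) (at \<tau>)"
    unfolding moving_frame_def
    by (intro has_vector_derivative_add has_vector_derivative_const
        bounded_linear.has_vector_derivative[OF bounded_linear_scaleR_left]
        smooth_on_has_vector_derivative[OF smooth_h assms(1)])
  then have derivative: "vector_derivative (\<lambda>t. moving_frame t u) (at \<tau>) =
      vector_derivative h (at \<tau>) *\<^sub>R f u"
    by (simp add: vector_derivative_at)
  have "velocity_form \<omega> \<Gamma> \<tau> (moving_frame \<tau> u) =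
      \<omega> (moving_frame \<tau> u) (vector_derivative (\<lambda>t. moving_frame t u) (at \<tau>))"
  proof (rule velocity_form_eq[OF symplectic open_J assms(1)])
    show "smooth_on J (\<lambda>t. moving_frame t u)"
      unfolding moving_frame_def
      by (intro smooth_on_add smooth_on_const bounded_linear.smooth_on[OF bounded_linear_scaleR_left]
          open_J smooth_h)
    show "moving_frame t u \<in> \<Gamma> t" if "t \<in> J" for t
      using assms(2) \<Gamma>_eq_image[OF that] by simp
    show "\<omega> x y = 0" if "t \<in> J" "x \<in> \<Gamma> t" "y \<in> \<Gamma> t" for t x y
      using lagrangianD(2)[OF \<Gamma>_lagrangian[OF that(1)] that(2,3)] .
  qed
  then show ?thesis
    unfolding derivative using assms(2) by (simp add: moving_frame_def bilinear_simps isotropic_f)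
qed

lemma velocity_form_polarization:
  assumes "\<tau> \<in> J" "u \<in> S" "v \<in> S"
  shows "velocity_form \<omega> \<Gamma> \<tau> (moving_frame \<tau> u + moving_frame \<tau> v) -
    velocity_form \<omega> \<Gamma> \<tau> (moving_frame \<tau> u) - velocity_form \<omega> \<Gamma> \<tau> (moving_frame \<tau> v) =
    2 * vector_derivative h (at \<tau>) * \<omega> (e u) (f v)"
  using velocity_form_moving_frame[OF assms(1) subspace_add[OF subspace assms(2,3)]]
    velocity_form_moving_frame[OF assms(1,2)] velocity_form_moving_frame[OF assms(1,3)]
    symmetric[OF assms(2,3)]
  by (simp add: moving_frame_add linear_simps bilinear_simps algebra_simps)

lemma nondegenerate_velocity_form_iff:
  assumes "\<tau> \<in> J"
  shows "nondegenerate_quadratic_on (\<Gamma> \<tau>) (velocity_form \<omega> \<Gamma> \<tau>) \<longleftrightarrow>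
    vector_derivative h (at \<tau>) \<noteq> 0"
proof -
  let ?h' = "vector_derivative h (at \<tau>)" and ?p = "moving_frame \<tau>" and ?q = "velocity_form \<omega> \<Gamma> \<tau>"
  note \<Gamma> = \<Gamma>_eq_image[OF assms]
  obtain u where u: "u \<in> S" "u \<noteq> 0" by (rule nonzero_exists)
  show ?thesis
  proof
    assume "nondegenerate_quadratic_on (\<Gamma> \<tau>) ?q"
    moreover have "?p u \<noteq> 0"
      using moving_frame_eq_f(1)[OF u(1) subspace_0[OF subspace]] u(2) by (auto simp: linear_simps)
    ultimately obtain v where "v \<in> S" "?q (?p u + ?p v) - ?q (?p u) - ?q (?p v) \<noteq> 0"
      using u(1) unfolding nondegenerate_quadratic_on_def \<Gamma> by blast
    then show "?h' \<noteq> 0" using velocity_form_polarization[OF assms u(1)] by auto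
  next
    assume "?h' \<noteq> 0"
    have "?p u = 0" if u: "u \<in> S" and zero: "\<forall>v\<in>S. ?q (?p u + ?p v) - ?q (?p u) - ?q (?p v) = 0" for u
    proof -
      have "\<omega> (e u) (f v) = 0" if "v \<in> S" for v
        using zero velocity_form_polarization[OF assms u that] that \<open>?h' \<noteq> 0\<close> by simp
      then have "u = 0" using \<omega>_e_f_nondegenerate[OF u] by blast
      then show ?thesis by (simp add: moving_frame_def linear_simps)
    qed
    then show "nondegenerate_quadratic_on (\<Gamma> \<tau>) ?q"
      unfolding nondegenerate_quadratic_on_def \<Gamma> by blast
  qed
qed

end

context lagrangian_pencil
begin

lemma injective_jacobi_curve_onto_line:
  "injective_jacobi_curve_onto \<omega> (range (plane 1)) UNIV (plane 1)"
proof -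
  interpret pencil_curve \<omega> S e f UNIV "\<lambda>t. t" "plane 1"
    by unfold_locales (simp_all add: smooth_on_ident)
  have "jacobi_curve \<omega> UNIV (plane 1)"
    using smooth_curve nondegenerate_velocity_form_iff
    by (simp add: jacobi_curve_def open_interval_def)
  then show ?thesis
    by (simp add: injective_jacobi_curve_onto_def inj_plane_1)
qed

lemma jacobi_curve_in_line:
  assumes "jacobi_curve \<omega> I \<gamma>" "\<gamma> ` I \<subseteq> range (plane 1)"
  obtains g where "pencil_curve \<omega> S e f I g \<gamma>" "\<And>s. s \<in> I \<Longrightarrow> vector_derivative g (at s) \<noteq> 0"
proof -
  have "open I" and smooth: "smooth_lagrangian_curve \<omega> I \<gamma>"
    and nondegenerate: "\<And>s. s \<in> I \<Longrightarrow> nondegenerate_quadratic_on (\<gamma> s) (velocity_form \<omega> \<gamma> s)"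
    using assms(1) by (auto simp: jacobi_curve_def open_interval_def)
  have "\<exists>x. \<gamma> s = plane 1 x" if "s \<in> I" for s
    using assms(2) that by blast
  then obtain g where g: "\<And>s. s \<in> I \<Longrightarrow> \<gamma> s = plane 1 (g s)" by metis
  interpret pencil_curve \<omega> S e f I g \<gamma>
    using \<open>open I\<close> smooth_on_coordinate[OF smooth g] g by unfold_locales
  show ?thesis
    using that[OF pencil_curve_axioms] nondegenerate nondegenerate_velocity_form_iff by blast
qed

lemma reparametrization_of_line:
  assumes "reparametrization \<omega> (range (plane 1)) J \<Gamma>"
  obtains h where "pencil_curve \<omega> S e f J h \<Gamma>" "\<And>t. t \<in> J \<Longrightarrow> vector_derivative h (at t) \<noteq> 0"
proof -
  obtain I \<gamma> \<phi> where "open J" and \<gamma>: "injective_jacobi_curve_onto \<omega> (range (plane 1)) I \<gamma>"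
    and \<phi>: "\<phi> ` J \<subseteq> I" "smooth_on J \<phi>" "\<And>t. t \<in> J \<Longrightarrow> vector_derivative \<phi> (at t) \<noteq> 0"
    and \<Gamma>: "\<And>t. t \<in> J \<Longrightarrow> \<Gamma> t = \<gamma> (\<phi> t)"
    using assms unfolding reparametrization_def open_interval_def by blast
  have "jacobi_curve \<omega> I \<gamma>" "\<gamma> ` I \<subseteq> range (plane 1)"
    using \<gamma> by (auto simp: injective_jacobi_curve_onto_def)
  then obtain g where curve: "pencil_curve \<omega> S e f I g \<gamma>"
    and g': "\<And>s. s \<in> I \<Longrightarrow> vector_derivative g (at s) \<noteq> 0"
    by (rule jacobi_curve_in_line) (rule that)
  interpret \<gamma>: pencil_curve \<omega> S e f I g \<gamma> by (rule curve)
  have \<phi>_in: "\<phi> t \<in> I" if "t \<in> J" for t using \<phi>(1) that by blast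
  show ?thesis
  proof (rule that)
    show "pencil_curve \<omega> S e f J (\<lambda>t. g (\<phi> t)) \<Gamma>"
      using \<open>open J\<close> smooth_on_compose[OF \<open>open J\<close> \<gamma>.open_J \<phi>(1) \<gamma>.smooth_h \<phi>(2)]
        \<Gamma> \<gamma>.\<Gamma>_eq_plane[OF \<phi>_in]
      by unfold_locales auto
    fix t assume t: "t \<in> J"
    have "((g \<circ> \<phi>) has_vector_derivative
        vector_derivative \<phi> (at t) *\<^sub>R vector_derivative g (at (\<phi> t))) (at t)"
      using smooth_on_has_vector_derivative[OF \<phi>(2) t]
        smooth_on_has_vector_derivative[OF \<gamma>.smooth_h \<phi>_in[OF t]]
      by (rule vector_diff_chain_at)
    then show "vector_derivative (\<lambda>t. g (\<phi> t)) (at t) \<noteq> 0"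
      using \<phi>(3)[OF t] g'[OF \<phi>_in[OF t]] by (simp add: vector_derivative_at o_def)
  qed
qed

end

section \<open>Curvature\<close>

lemma trace_on_scaleR:
  fixes S :: "'a::euclidean_space set"
  assumes "subspace S" "\<And>v. v \<in> S \<Longrightarrow> f v = c *\<^sub>R v"
  shows "trace_on S f = c * real (dim S)"
proof -
  define B where "B = (SOME B. independent B \<and> span B = S)"
  have "\<exists>B. independent B \<and> span B = S"
    by (rule basis_exists[of S]) (use assms(1) span_subspace in blast)
  then have B: "independent B" "span B = S"
    unfolding B_def by (metis (mono_tags, lifting) someI_ex)+
  have "representation B (f b) b = c" if "b \<in> B" for b
  proof -
    have "b \<in> span B" using that by (rule span_base)
    then show ?thesis
      using assms(2) B that by (simp add: representation_scale representation_basis)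
  qed
  then have "trace_on S f = real (card B) * c"
    unfolding trace_on_def Let_def B_def[symmetric] by simp
  also have "card B = dim S"
    using dim_eq_card_independent[OF B(1)] dim_span[of B] B(2) by simp
  finally show ?thesis by simp
qed

definition schwarzian :: "(real \<Rightarrow> real) \<Rightarrow> real \<Rightarrow> real" where
  "schwarzian h t = nth_deriv 3 h t / nth_deriv 1 h t - 3 / 2 * (nth_deriv 2 h t / nth_deriv 1 h t)\<^sup>2"

lemma nth_deriv_operator_fixing_vector:
  fixes R :: "real \<Rightarrow> 'a::real_normed_vector \<Rightarrow>\<^sub>L 'a"
  assumes "open V" "t \<in> V" and R: "smooth_on V R" and h: "smooth_on V h"
    and fixing: "\<And>s. s \<in> V \<Longrightarrow> R s (v + h s *\<^sub>R w) = v + h s *\<^sub>R w"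
  shows "nth_deriv 1 R t (v + h t *\<^sub>R w) = nth_deriv 1 h t *\<^sub>R (w - R t w)"
    and "nth_deriv 2 R t (v + h t *\<^sub>R w) =
      nth_deriv 2 h t *\<^sub>R (w - R t w) - (2 * nth_deriv 1 h t) *\<^sub>R nth_deriv 1 R t w"
    and "nth_deriv 3 R t (v + h t *\<^sub>R w) = nth_deriv 3 h t *\<^sub>R (w - R t w) -
      (3 * nth_deriv 2 h t) *\<^sub>R nth_deriv 1 R t w - (3 * nth_deriv 1 h t) *\<^sub>R nth_deriv 2 R t w"
proof -
  let ?p = "\<lambda>s. v + h s *\<^sub>R w"
  have "smooth_on V (\<lambda>s. h s *\<^sub>R w)"
    by (rule bounded_linear.smooth_on[OF bounded_linear_scaleR_left assms(1) h])
  then have diff: "higher_differentiable_on k V R" "higher_differentiable_on k V h"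
    "higher_differentiable_on k V (\<lambda>s. v)" "higher_differentiable_on k V (\<lambda>s. h s *\<^sub>R w)" for k
    using R h smooth_on_const[OF assms(1), of v] by (auto simp: smooth_on_iff_higher_differentiable_on)
  note diff_p = higher_differentiable_on_add[OF assms(1) diff(3,4)]
  have deriv_p: "nth_deriv (Suc k) ?p t = nth_deriv (Suc k) h t *\<^sub>R w" for k
    using nth_deriv_add[OF assms(1) diff(3,4) order_refl assms(2)]
      bounded_linear.nth_deriv[OF bounded_linear_scaleR_left[of w] assms(1) diff(2) order_refl assms(2)]
    by (simp add: nth_deriv_const[OF assms(1,2)])
  have "nth_deriv k (\<lambda>s. R s (?p s)) t = nth_deriv k ?p t" for k
    by (rule nth_deriv_cong[OF assms(1) _ diff_p order_refl assms(2)]) (rule fixing)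
  then have Leibniz: "(\<Sum>i\<le>k. real (k choose i) *\<^sub>R nth_deriv i R t (nth_deriv (k - i) ?p t)) =
      nth_deriv k ?p t" for k
    by (simp only: bounded_bilinear.nth_deriv[OF bounded_bilinear_blinfun_apply assms(1) diff(1) diff_p
          order_refl assms(2)])
  show "nth_deriv 1 R t (?p t) = nth_deriv 1 h t *\<^sub>R (w - R t w)"
    using Leibniz[of 1] by (simp add: deriv_p blinfun.bilinear_simps algebra_simps)
  show "nth_deriv 2 R t (?p t) =
      nth_deriv 2 h t *\<^sub>R (w - R t w) - (2 * nth_deriv 1 h t) *\<^sub>R nth_deriv 1 R t w"
    using Leibniz[of 2] by (simp add: eval_nat_numeral deriv_p blinfun.bilinear_simps algebra_simps)
  show "nth_deriv 3 R t (?p t) = nth_deriv 3 h t *\<^sub>R (w - R t w) -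
      (3 * nth_deriv 2 h t) *\<^sub>R nth_deriv 1 R t w - (3 * nth_deriv 1 h t) *\<^sub>R nth_deriv 2 R t w"
    using Leibniz[of 3] by (simp add: eval_nat_numeral deriv_p blinfun.bilinear_simps algebra_simps)
qed

context pencil_curve
begin

lemma chart_deriv_moving_frame:
  fixes D :: "'a set"
  assumes "\<tau> \<in> J" and compl: "complementary (\<Gamma> \<tau>) D" and "u \<in> S"
  defines "Q \<equiv> id_blinfun - projection_along (\<Gamma> \<tau>) D"
  shows "chart_deriv \<Gamma> \<tau> D 1 (moving_frame \<tau> u) = nth_deriv 1 h \<tau> *\<^sub>R Q (f u)"
    and "chart_deriv \<Gamma> \<tau> D 2 (moving_frame \<tau> u) =
      nth_deriv 2 h \<tau> *\<^sub>R Q (f u) - (2 * nth_deriv 1 h \<tau>) *\<^sub>R chart_deriv \<Gamma> \<tau> D 1 (f u)"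
    and "chart_deriv \<Gamma> \<tau> D 3 (moving_frame \<tau> u) =
      nth_deriv 3 h \<tau> *\<^sub>R Q (f u) - (3 * nth_deriv 2 h \<tau>) *\<^sub>R chart_deriv \<Gamma> \<tau> D 1 (f u) -
      (3 * nth_deriv 1 h \<tau>) *\<^sub>R chart_deriv \<Gamma> \<tau> D 2 (f u)"
proof -
  obtain V where V: "open V" "\<tau> \<in> V" "V \<subseteq> J" "\<And>t. t \<in> V \<Longrightarrow> complementary (\<Gamma> t) D"
    and smooth: "smooth_on V (\<lambda>t. projection_along (\<Gamma> t) D)"
    by (rule smooth_lagrangian_curve_projection_along[OF smooth_curve assms(1) compl]) (rule that)
  have fixing: "projection_along (\<Gamma> t) D (e u + h t *\<^sub>R f u) = e u + h t *\<^sub>R f u" if "t \<in> V" for t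
  proof (rule projection_along_ident[OF V(4)[OF that]])
    show "e u + h t *\<^sub>R f u \<in> \<Gamma> t"
      using \<Gamma>_eq_image[of t] V(3) that assms(3) by (auto simp: moving_frame_def)
  qed
  have deriv: "chart_deriv \<Gamma> \<tau> D k = nth_deriv k (\<lambda>t. projection_along (\<Gamma> t) D) \<tau>" if "k > 0" for k
    using V(1,2,4) smooth that by (rule chart_deriv_eq_nth_deriv_projection_along)
  have Q: "Q (f u) = f u - projection_along (\<Gamma> \<tau>) D (f u)"
    by (simp add: Q_def blinfun.diff_left)
  note nth_deriv_operator_fixing_vector
    [where R = "\<lambda>t. projection_along (\<Gamma> t) D", OF V(1,2) smooth
      smooth_on_subset[OF smooth_h V(3)] fixing]
  then show "chart_deriv \<Gamma> \<tau> D 1 (moving_frame \<tau> u) = nth_deriv 1 h \<tau> *\<^sub>R Q (f u)"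
    "chart_deriv \<Gamma> \<tau> D 2 (moving_frame \<tau> u) =
      nth_deriv 2 h \<tau> *\<^sub>R Q (f u) - (2 * nth_deriv 1 h \<tau>) *\<^sub>R chart_deriv \<Gamma> \<tau> D 1 (f u)"
    "chart_deriv \<Gamma> \<tau> D 3 (moving_frame \<tau> u) =
      nth_deriv 3 h \<tau> *\<^sub>R Q (f u) - (3 * nth_deriv 2 h \<tau>) *\<^sub>R chart_deriv \<Gamma> \<tau> D 1 (f u) -
      (3 * nth_deriv 1 h \<tau>) *\<^sub>R chart_deriv \<Gamma> \<tau> D 2 (f u)"
    unfolding moving_frame_def Q by (simp_all add: deriv)
qed

lemma chart_deriv_projection_along:
  assumes "\<tau> \<in> J" "complementary (\<Gamma> \<tau>) D" "k > 0"
  shows "chart_deriv \<Gamma> \<tau> D k (projection_along (\<Gamma> \<tau>) D w) = chart_deriv \<Gamma> \<tau> D k w"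
  using chart_deriv_eq_0[OF smooth_curve assms(1-3) diff_projection_along_in[OF assms(2)], of w]
  by (simp add: blinfun.diff_right)

lemma f_in_\<Gamma>_imp_eq_0:
  assumes "\<tau> \<in> J" "u \<in> S" "f u \<in> \<Gamma> \<tau>"
  shows "u = 0"
proof -
  obtain v where "v \<in> S" "moving_frame \<tau> v = f u"
    using assms(3) unfolding \<Gamma>_eq_image[OF assms(1)] by force
  then show ?thesis using assms(2) by (intro moving_frame_eq_f(2))
qed

lemma chart_deriv_2_moving_frame:
  fixes D :: "'a set"
  assumes "\<tau> \<in> J" and compl: "complementary (\<Gamma> \<tau>) D" and u: "u \<in> S" and u': "u' \<in> S"
    and component: "projection_along (\<Gamma> \<tau>) D (f u) = moving_frame \<tau> u'"
  shows "chart_deriv \<Gamma> \<tau> D 2 (moving_frame \<tau> u) = (id_blinfun - projection_along (\<Gamma> \<tau>) D)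
    (f (nth_deriv 2 h \<tau> *\<^sub>R u - (2 * (nth_deriv 1 h \<tau>)\<^sup>2) *\<^sub>R u'))"
proof -
  have "chart_deriv \<Gamma> \<tau> D 1 (f u) =
      nth_deriv 1 h \<tau> *\<^sub>R (id_blinfun - projection_along (\<Gamma> \<tau>) D) (f u')"
    using chart_deriv_projection_along[OF assms(1) compl, of 1 "f u"]
      chart_deriv_moving_frame(1)[OF assms(1) compl u'] component by simp
  then show ?thesis
    using chart_deriv_moving_frame(2)[OF assms(1) compl u]
    by (simp add: linear_simps blinfun.diff_right blinfun.scaleR_right power2_eq_square)
qed

definition osculating_slope :: "real \<Rightarrow> real" where
  "osculating_slope \<tau> = nth_deriv 2 h \<tau> / (2 * (nth_deriv 1 h \<tau>)\<^sup>2)"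

definition osculating_plane :: "real \<Rightarrow> 'a set" where
  "osculating_plane \<tau> = (\<lambda>u. f u - osculating_slope \<tau> *\<^sub>R moving_frame \<tau> u) ` S"

lemma osculating_plane_in_pencil:
  obtains l where "osculating_plane \<tau> = plane l (1 + l * h \<tau>)"
proof
  let ?l = "- osculating_slope \<tau>"
  show "osculating_plane \<tau> = plane ?l (1 + ?l * h \<tau>)"
    unfolding osculating_plane_def pencil_plane_def moving_frame_def
    by (intro image_cong) (simp_all add: algebra_simps)
qed

lemma osculating_plane_lagrangian: "osculating_plane \<tau> \<in> lagrangian_grassmannian \<omega>"
proof -
  obtain l where "osculating_plane \<tau> = plane l (1 + l * h \<tau>)"
    by (rule osculating_plane_in_pencil)
  then show ?thesis using plane_lagrangian[of l "1 + l * h \<tau>"] by auto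
qed

lemma osculating_plane_complementary:
  assumes "\<tau> \<in> J"
  shows "complementary (\<Gamma> \<tau>) (osculating_plane \<tau>)"
proof -
  obtain l where "osculating_plane \<tau> = plane l (1 + l * h \<tau>)"
    by (rule osculating_plane_in_pencil)
  then show ?thesis
    using plane_complementary[of 1 "1 + l * h \<tau>" "h \<tau>" l] by (simp add: \<Gamma>_eq_plane[OF assms])
qed

lemma eq_osculating_plane_of_chart_deriv_2_eq_0:
  assumes \<tau>: "\<tau> \<in> J" and h': "nth_deriv 1 h \<tau> \<noteq> 0"
    and D: "D \<in> transversals \<omega> (\<Gamma> \<tau>)" and zero: "chart_deriv \<Gamma> \<tau> D 2 = 0"
  shows "D = osculating_plane \<tau>"
proof -
  have compl: "complementary (\<Gamma> \<tau>) D" and D_lagrangian: "D \<in> lagrangian_grassmannian \<omega>"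
    using D transversals_iff_complementary[OF \<Gamma>_lagrangian[OF \<tau>]] complementary_sym by blast+
  let ?P = "projection_along (\<Gamma> \<tau>) D"
  have "f u - osculating_slope \<tau> *\<^sub>R moving_frame \<tau> u \<in> D" if u: "u \<in> S" for u
  proof -
    have "?P (f u) \<in> moving_frame \<tau> ` S"
      unfolding \<Gamma>_eq_image[OF \<tau>, symmetric] by (rule projection_along_in[OF compl])
    then obtain u' where u': "u' \<in> S" "?P (f u) = moving_frame \<tau> u'" by blast
    define y where "y = nth_deriv 2 h \<tau> *\<^sub>R u - (2 * (nth_deriv 1 h \<tau>)\<^sup>2) *\<^sub>R u'"
    have "?P (f y) = f y"
      using chart_deriv_2_moving_frame[OF \<tau> compl u u'] zero by (simp add: y_def blinfun.diff_left)
    then have "f y \<in> \<Gamma> \<tau>" by (metis projection_along_in[OF compl])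
    moreover have "y \<in> S"
      using u u'(1) subspace by (simp add: y_def subspace_diff subspace_scale)
    ultimately have "y = 0" by (intro f_in_\<Gamma>_imp_eq_0[OF \<tau>])
    then have "u' = osculating_slope \<tau> *\<^sub>R u"
      using h' by (simp add: y_def osculating_slope_def eq_vector_fraction_iff)
    then show ?thesis
      using diff_projection_along_in[OF compl, of "f u"] u'(2)
      by (simp add: moving_frame_def linear_simps algebra_simps)
  qed
  then have "osculating_plane \<tau> \<subseteq> D"
    unfolding osculating_plane_def by blast
  then have "osculating_plane \<tau> = D"
    using lagrangianD(1,3)[OF osculating_plane_lagrangian, of \<tau>] lagrangianD(1,3)[OF D_lagrangian]
    by (intro subspace_dim_equal) auto
  then show ?thesis by simp
qed

lemma projection_along_osculating_plane:
  assumes "\<tau> \<in> J" "u \<in> S"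
  shows "projection_along (\<Gamma> \<tau>) (osculating_plane \<tau>) (f u) =
    moving_frame \<tau> (osculating_slope \<tau> *\<^sub>R u)"
proof (rule projection_along_eqI[OF osculating_plane_complementary[OF assms(1)]])
  have "moving_frame \<tau> (osculating_slope \<tau> *\<^sub>R u) = osculating_slope \<tau> *\<^sub>R moving_frame \<tau> u"
    by (simp add: moving_frame_def linear_simps scaleR_add_right mult.commute)
  then show "f u - moving_frame \<tau> (osculating_slope \<tau> *\<^sub>R u) \<in> osculating_plane \<tau>"
    using assms(2) by (simp add: osculating_plane_def)
  show "moving_frame \<tau> (osculating_slope \<tau> *\<^sub>R u) \<in> \<Gamma> \<tau>"
    unfolding \<Gamma>_eq_image[OF assms(1)] using subspace_scale[OF subspace assms(2)] by (rule imageI)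
qed

lemma chart_deriv_2_osculating_plane:
  assumes \<tau>: "\<tau> \<in> J" and h': "nth_deriv 1 h \<tau> \<noteq> 0"
  shows "chart_deriv \<Gamma> \<tau> (osculating_plane \<tau>) 2 = 0"
proof (rule blinfun_eqI)
  fix w
  let ?D = "osculating_plane \<tau>"
  have compl: "complementary (\<Gamma> \<tau>) ?D" using \<tau> by (rule osculating_plane_complementary)
  have "projection_along (\<Gamma> \<tau>) ?D w \<in> moving_frame \<tau> ` S"
    unfolding \<Gamma>_eq_image[OF \<tau>, symmetric] by (rule projection_along_in[OF compl])
  then obtain u where u: "u \<in> S" "projection_along (\<Gamma> \<tau>) ?D w = moving_frame \<tau> u" by blast
  have "nth_deriv 2 h \<tau> *\<^sub>R u - (2 * (nth_deriv 1 h \<tau>)\<^sup>2) *\<^sub>R (osculating_slope \<tau> *\<^sub>R u) = 0"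
    using h' by (simp add: osculating_slope_def)
  then have "chart_deriv \<Gamma> \<tau> ?D 2 (moving_frame \<tau> u) = 0"
    using chart_deriv_2_moving_frame[OF \<tau> compl u(1) subspace_scale[OF subspace u(1)]
      projection_along_osculating_plane[OF \<tau> u(1)]]
    by (simp only: linear_simps blinfun.zero_right)
  then show "chart_deriv \<Gamma> \<tau> ?D 2 w = blinfun_apply 0 w"
    using chart_deriv_projection_along[OF \<tau> compl, of 2 w] u(2) by simp
qed

lemma chart_deriv_3_osculating_plane:
  assumes \<tau>: "\<tau> \<in> J" and h': "nth_deriv 1 h \<tau> \<noteq> 0" and "v \<in> \<Gamma> \<tau>"
  shows "chart_deriv \<Gamma> \<tau> (osculating_plane \<tau>) 3 v =
    schwarzian h \<tau> *\<^sub>R chart_deriv \<Gamma> \<tau> (osculating_plane \<tau>) 1 v"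
proof -
  let ?D = "osculating_plane \<tau>" and ?\<mu> = "osculating_slope \<tau>"
  let ?h' = "nth_deriv 1 h \<tau>" and ?h'' = "nth_deriv 2 h \<tau>" and ?h''' = "nth_deriv 3 h \<tau>"
  have compl: "complementary (\<Gamma> \<tau>) ?D" using \<tau> by (rule osculating_plane_complementary)
  let ?Q = "id_blinfun - projection_along (\<Gamma> \<tau>) ?D"
  obtain u where u: "u \<in> S" "v = moving_frame \<tau> u" using assms(3) \<Gamma>_eq_image[OF \<tau>] by blast
  note deriv = chart_deriv_moving_frame[OF \<tau> compl]
  have "chart_deriv \<Gamma> \<tau> ?D 1 (f u) = ?h' *\<^sub>R ?Q (f (?\<mu> *\<^sub>R u))"
    using chart_deriv_projection_along[OF \<tau> compl, of 1 "f u"]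
      deriv(1)[OF subspace_scale[OF subspace u(1)]]
    by (simp add: projection_along_osculating_plane[OF \<tau> u(1)])
  then have "chart_deriv \<Gamma> \<tau> ?D 3 v = (?h''' - 3 * ?h'' * ?h' * ?\<mu>) *\<^sub>R ?Q (f u)"
    using deriv(3)[OF u(1)] chart_deriv_2_osculating_plane[OF \<tau> h']
    by (simp add: u(2) linear_simps blinfun.scaleR_right scaleR_diff_left)
  also have "?h''' - 3 * ?h'' * ?h' * ?\<mu> = schwarzian h \<tau> * ?h'"
    using h' by (simp add: osculating_slope_def schwarzian_def field_simps power2_eq_square)
  also have "(schwarzian h \<tau> * ?h') *\<^sub>R ?Q (f u) = schwarzian h \<tau> *\<^sub>R chart_deriv \<Gamma> \<tau> ?D 1 v"
    using deriv(1)[OF u(1)] by (simp add: u(2))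
  finally show ?thesis .
qed

lemma derivative_lagrangian_eq_osculating_plane:
  assumes "\<tau> \<in> J" "nth_deriv 1 h \<tau> \<noteq> 0"
  shows "derivative_lagrangian \<omega> \<Gamma> \<tau> = osculating_plane \<tau>"
  unfolding derivative_lagrangian_def
proof (rule the_equality)
  show "osculating_plane \<tau> \<in> transversals \<omega> (\<Gamma> \<tau>) \<and> chart_deriv \<Gamma> \<tau> (osculating_plane \<tau>) 2 = 0"
    using chart_deriv_2_osculating_plane[OF assms] osculating_plane_lagrangian
      complementary_sym[OF osculating_plane_complementary[OF assms(1)]]
    by (simp add: transversals_iff_complementary[OF \<Gamma>_lagrangian[OF assms(1)]])
  show "D = osculating_plane \<tau>" if "D \<in> transversals \<omega> (\<Gamma> \<tau>) \<and> chart_deriv \<Gamma> \<tau> D 2 = 0" for D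
    using that by (intro eq_osculating_plane_of_chart_deriv_2_eq_0 assms) auto
qed

lemma inj_on_chart_deriv_1:
  assumes "\<tau> \<in> J" "nth_deriv 1 h \<tau> \<noteq> 0" and compl: "complementary (\<Gamma> \<tau>) D"
  shows "inj_on (chart_deriv \<Gamma> \<tau> D 1) (\<Gamma> \<tau>)"
proof -
  have "w = 0" if w: "w \<in> \<Gamma> \<tau>" "chart_deriv \<Gamma> \<tau> D 1 w = 0" for w
  proof -
    obtain u where u: "u \<in> S" "w = moving_frame \<tau> u" using w(1) \<Gamma>_eq_image[OF assms(1)] by blast
    have "projection_along (\<Gamma> \<tau>) D (f u) = f u"
      using chart_deriv_moving_frame(1)[OF assms(1) compl u(1)] w(2) u(2) assms(2)
      by (simp add: blinfun.diff_left)
    then have "f u \<in> \<Gamma> \<tau>" by (metis projection_along_in[OF compl])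
    then have "u = 0" by (rule f_in_\<Gamma>_imp_eq_0[OF assms(1) u(1)])
    then show ?thesis by (simp add: u(2) moving_frame_def linear_simps)
  qed
  then show ?thesis
    using linear_inj_on_iff_eq_0[OF bounded_linear.linear[OF blinfun.bounded_linear_right]
      complementaryD(1)[OF compl]] by blast
qed

lemma curvature_operator_eq_schwarzian:
  assumes "\<tau> \<in> J" "nth_deriv 1 h \<tau> \<noteq> 0" "v \<in> \<Gamma> \<tau>"
  shows "curvature_operator \<omega> \<Gamma> \<tau> v = schwarzian h \<tau> *\<^sub>R v"
proof -
  let ?D = "osculating_plane \<tau>"
  have compl: "complementary (\<Gamma> \<tau>) ?D" using assms(1) by (rule osculating_plane_complementary)
  have "chart_deriv \<Gamma> \<tau> ?D 3 v = chart_deriv \<Gamma> \<tau> ?D 1 (schwarzian h \<tau> *\<^sub>R v)"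
    using chart_deriv_3_osculating_plane[OF assms] by (simp add: blinfun.scaleR_right)
  moreover have "schwarzian h \<tau> *\<^sub>R v \<in> \<Gamma> \<tau>"
    by (rule subspace_scale[OF complementaryD(1)[OF compl] assms(3)])
  ultimately show ?thesis
    unfolding curvature_operator_def Let_def derivative_lagrangian_eq_osculating_plane[OF assms(1,2)]
    using inv_into_f_f[OF inj_on_chart_deriv_1[OF assms(1,2) compl]] by simp
qed

lemma curvature_operator_eq_0_of_projective:
  assumes "projective \<omega> J \<Gamma>" "\<tau> \<in> J" "nth_deriv 1 h \<tau> \<noteq> 0" "v \<in> \<Gamma> \<tau>"
  shows "curvature_operator \<omega> \<Gamma> \<tau> v = 0"
proof -
  note curvature = curvature_operator_eq_schwarzian[OF assms(2,3)]
  note lagrangian = \<Gamma>_lagrangian[OF assms(2)]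
  have "schwarzian h \<tau> * real (dim (\<Gamma> \<tau>)) = trace_on (\<Gamma> \<tau>) (curvature_operator \<omega> \<Gamma> \<tau>)"
    using trace_on_scaleR[OF lagrangianD(1)[OF lagrangian] curvature] by simp
  also have "\<dots> = 0" using assms(1,2) by (simp add: projective_def)
  finally have "schwarzian h \<tau> = 0" using dim_lagrangian_pos[OF lagrangian] by (simp del: dim_eq_0)
  then show ?thesis using curvature[OF assms(4)] by simp
qed

end

theorem proposition5:
  fixes \<omega> :: "'a::euclidean_space \<Rightarrow> 'a \<Rightarrow> real" and n :: nat and C :: "'a set set"
  assumes "symplectic_form \<omega>" and "DIM('a) = 2 * n" and "regular_cycle \<omega> C"
  shows "\<forall>\<Lambda>\<in>C. is_jacobi_curve_set \<omega> (C - {\<Lambda>}) \<and>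
           (\<forall>J \<Gamma>. reparametrization \<omega> (C - {\<Lambda>}) J \<Gamma> \<longrightarrow> projective \<omega> J \<Gamma> \<longrightarrow>
              (\<forall>t\<in>J. \<forall>v\<in>\<Gamma> t. curvature_operator \<omega> \<Gamma> t v = 0))"
proof (intro ballI conjI allI impI)
  fix \<Lambda> assume "\<Lambda> \<in> C"
  then obtain S :: "'a set" and e f where "lagrangian_pencil \<omega> S e f"
    and line: "C - {\<Lambda>} = range (pencil_plane S e f 1)"
    by (rule regular_cycle_minus[OF assms(1,3)])
  then interpret lagrangian_pencil \<omega> S e f by blast
  show "is_jacobi_curve_set \<omega> (C - {\<Lambda>})"
    unfolding line is_jacobi_curve_set_def using injective_jacobi_curve_onto_line by blast
  fix J \<Gamma> t v
  assume "reparametrization \<omega> (C - {\<Lambda>}) J \<Gamma>" and curve: "projective \<omega> J \<Gamma>" "t \<in> J" "v \<in> \<Gamma> t"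
  then obtain h where "pencil_curve \<omega> S e f J h \<Gamma>"
    and "nth_deriv 1 h t \<noteq> 0"
    unfolding line using reparametrization_of_line by (metis nth_deriv_1)
  with curve show "curvature_operator \<omega> \<Gamma> t v = 0"
    by (intro pencil_curve.curvature_operator_eq_0_of_projective)
qed

end
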